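(* Let $K:\mathbb{S}^2\times\mathbb{S}^2\to\mathbb{C}$ be a continuous kernel with $K(\xi,\zeta)=\overline{K(\zeta,\xi)}$ for all $\xi,\zeta\in\mathbb{S}^2$, represented as $$K(\xi,\zeta)=\sum_{\ell,\ell'=1}^{\infty}a_{\ell,\ell'}F_\ell(\xi)\overline{F_{\ell'}(\zeta)},\qquad \forall\,\xi,\zeta\in\mathbb{S}^2,$$ where $(F_\ell)_{\ell\ge1}$ is an orthonormal basis of $L^2(\mathbb{S}^2)$ consisting of eigenfunctions of the Laplace-Beltrami operator. Let $Y=\operatorname{span}\{(F_\ell(\xi))_{\ell=1}^\infty : \xi\in\mathbb{S}^2\}\subset\mathbb{C}^\infty$ and, for $y\in Y$, let $A(y)=\left(\sum_{\ell=1}^\infty a_{\ell,\ell'}y_\ell\right)_{\ell'=1}^\infty$. Then $K$ is strictly positive definite on $\mathbb{S}^2$ if and only if $\langle A(y),y\rangle>0$ for all $y\in Y\setminus\{0\}$.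
   Context: $\mathbb{S}^2=\{\xi\in\mathbb{R}^3:\xi_1^2+\xi_2^2+\xi_3^2=1\}$ with its surface measure; $L^2(\mathbb{S}^2)$ is complex-valued. $\mathbb{C}^\infty$ is the vector space of all complex sequences indexed by $\ell\ge1$, and $\operatorname{span}$ is the set of finite complex linear combinations. For sequences, $\langle x,y\rangle=\sum_{\ell=1}^\infty\overline{x_\ell}y_\ell$. The numbers $a_{\ell,\ell'}=\int_{\mathbb{S}^2}\int_{\mathbb{S}^2}K(\xi,\zeta)\overline{F_\ell(\xi)}F_{\ell'}(\zeta)\,d\xi\,d\zeta$ are the $L^2(\mathbb{S}^2\times\mathbb{S}^2)$ expansion coefficients of $K$. Standing assumption: the series representing $K$ converges to $K(\xi,\zeta)$ for all $\xi,\zeta\in\mathbb{S}^2$; double series are read as iterated sums, inner sum over $\ell$ and outer sum over $\ell'$, consistently with the formula defining $A$. Consequently $A(y)$ and $\langle A(y),y\rangle$ are well defined and finite for every $y\in Y$ (such $y$ has the form $y_\ell=\sum_{\xi\in\Xi}c_\xi F_\ell(\xi)$ with $\Xi\subset\mathbb{S}^2$ finite and $c_\xi\in\mathbb{C}$). A Hermitian kernel $K$ is strictly positive definite on $\mathbb{S}^2$ if for every finite set $\Xi\subset\mathbb{S}^2$ of distinct points the matrix $K_\Xi=(K(\xi,\zeta))_{\xi,\zeta\in\Xi}$ induces, by left multiplication, a strictly positive operator on $\mathbb{C}^{|\Xi|}$, i.e. it is self-adjoint and $\langle K_\Xi x,x\rangle>0$ for all $x\in\mathbb{C}^{|\Xi|}\setminus\{0\}$.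 *)

theory Defs
  imports "HOL-Analysis.Analysis" "HOL-Library.Function_Algebras" "HOL-Library.Complex_Order"
begin

abbreviation S2 :: "(real ^ 3) set" where
  "S2 \<equiv> sphere 0 1"

text \<open>
  Throughout, functions on the sphere are functions on the whole of \<open>real ^ 3\<close> of which only the
  values on \<open>S2\<close> matter, and sequences indexed by \<open>1, 2, \<dots>\<close> are represented by functions on
  \<open>nat\<close> with the index shifted by one.  A strict inequality \<open>0 < z\<close> for complex \<open>z\<close> is the one of
  \<^theory>\<open>HOL-Library.Complex_Order\<close>: \<open>z\<close> is real and positive.
\<close>


subsection \<open>Surface measure\<close>

definition radial_proj :: "real ^ 3 \<Rightarrow> real ^ 3" where
  "radial_proj x = x /\<^sub>R norm x"

text \<open>
  The measure from integration in polar coordinates: the area of \<open>B\<close> is three times the volume of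
  the cone of all \<open>t *\<^sub>R \<xi>\<close> with \<open>\<xi> \<in> B\<close> and \<open>0 < t < 1\<close>.
\<close>

definition surface_measure :: "(real ^ 3) measure" where
  "surface_measure =
     scale_measure 3
       (distr (restrict_space lborel (ball 0 1 - {0})) (restrict_space borel S2) radial_proj)"

lemma space_surface_measure: "space surface_measure = S2"
  by (simp add: surface_measure_def space_scale_measure space_restrict_space)

lemma sets_surface_measure: "sets surface_measure = sets (restrict_space borel S2)"
  by (simp add: surface_measure_def)

lemma measurable_radial_proj:
  "radial_proj \<in> restrict_space lborel (ball 0 1 - {0}) \<rightarrow>\<^sub>M restrict_space borel S2"
proof (rule measurable_restrict_space2)
  show "radial_proj \<in> space (restrict_space lborel (ball 0 1 - {0})) \<rightarrow> S2"
    by (auto simp: radial_proj_def space_restrict_space)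
  have "radial_proj \<in> borel_measurable borel"
    unfolding radial_proj_def by measurable
  then show "radial_proj \<in> borel_measurable (restrict_space lborel (ball 0 1 - {0}))"
    by (intro measurable_restrict_space1) simp
qed

lemma emeasure_surface_measure:
  assumes "B \<in> sets (restrict_space borel S2)"
  shows "emeasure surface_measure B =
           3 * emeasure lborel {x \<in> ball 0 1 - {0}. radial_proj x \<in> B}"
proof -
  let ?\<Omega> = "ball 0 1 - {0} :: (real ^ 3) set"
  have "emeasure surface_measure B =
      3 * emeasure (restrict_space lborel ?\<Omega>) (radial_proj -` B \<inter> space (restrict_space lborel ?\<Omega>))"
    by (simp only: surface_measure_def emeasure_scale_measure
        emeasure_distr [OF measurable_radial_proj assms])
  also have "radial_proj -` B \<inter> space (restrict_space lborel ?\<Omega>) = {x \<in> ?\<Omega>. radial_proj x \<in> B}"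
    by (auto simp only: space_restrict_space space_lborel space_borel)
  also have "emeasure (restrict_space lborel ?\<Omega>) \<dots> = emeasure lborel \<dots>"
    by (rule emeasure_restrict_space) (simp, blast)
  finally show ?thesis .
qed

lemma emeasure_surface_measure_S2: "emeasure surface_measure S2 = ennreal (4 * pi)"
proof -
  have *: "{x \<in> ball 0 1 - {0}. radial_proj x \<in> S2} = ball (0 :: real ^ 3) 1 - {0}"
    by (auto simp: radial_proj_def)
  have "S2 \<in> sets (restrict_space borel S2)"
    by (metis sets.top space_restrict_space Int_UNIV_right space_borel)
  then have "emeasure surface_measure S2 = 3 * emeasure lborel (ball (0 :: real ^ 3) 1 - {0})"
    by (simp only: emeasure_surface_measure *)
  also have "emeasure lborel (ball (0 :: real ^ 3) 1 - {0}) = emeasure lborel (ball (0 :: real ^ 3) 1)"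
    by (rule emeasure_Diff_null_set) auto
  also have "\<dots> = ennreal (4 / 3 * pi)"
    by (simp add: emeasure_ball unit_ball_vol_3)
  also have "3 * ennreal (4 / 3 * pi) = ennreal (4 * pi)"
    by (simp flip: ennreal_numeral ennreal_mult)
  finally show ?thesis .
qed


subsection \<open>Orthonormal bases of \<open>L\<^sup>2(S2)\<close>\<close>

definition square_integrable :: "(real ^ 3 \<Rightarrow> complex) \<Rightarrow> bool" where
  "square_integrable f \<longleftrightarrow>
     f \<in> borel_measurable surface_measure \<and>
     integrable surface_measure (\<lambda>\<xi>. (cmod (f \<xi>))\<^sup>2)"

definition L2_inner :: "(real ^ 3 \<Rightarrow> complex) \<Rightarrow> (real ^ 3 \<Rightarrow> complex) \<Rightarrow> complex" where
  "L2_inner f g = (LINT \<xi>|surface_measure. cnj (f \<xi>) * g \<xi>)"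

definition L2_orthonormal_basis :: "(nat \<Rightarrow> real ^ 3 \<Rightarrow> complex) \<Rightarrow> bool" where
  "L2_orthonormal_basis F \<longleftrightarrow>
     (\<forall>l. square_integrable (F l)) \<and>
     (\<forall>l l'. L2_inner (F l) (F l') = (if l = l' then 1 else 0)) \<and>
     (\<forall>g. square_integrable g \<longrightarrow>
       (\<lambda>n. LINT \<xi>|surface_measure. (cmod (g \<xi> - (\<Sum>l<n. L2_inner (F l) g * F l \<xi>)))\<^sup>2)
         \<longlonglongrightarrow> 0)"


subsection \<open>The Laplace-Beltrami operator\<close>

definition partial_deriv :: "3 \<Rightarrow> (real ^ 3 \<Rightarrow> complex) \<Rightarrow> real ^ 3 \<Rightarrow> complex" where
  "partial_deriv i g x = frechet_derivative g (at x) (axis i 1)"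

definition C2_on :: "(real ^ 3) set \<Rightarrow> (real ^ 3 \<Rightarrow> complex) \<Rightarrow> bool" where
  "C2_on U g \<longleftrightarrow>
     (\<forall>x\<in>U. g differentiable at x) \<and>
     (\<forall>i. \<forall>x\<in>U. partial_deriv i g differentiable at x) \<and>
     (\<forall>i j. continuous_on U (partial_deriv j (partial_deriv i g)))"

definition laplacian :: "(real ^ 3 \<Rightarrow> complex) \<Rightarrow> real ^ 3 \<Rightarrow> complex" where
  "laplacian g x = (\<Sum>i\<in>UNIV. partial_deriv i (partial_deriv i g) x)"

text \<open>
  On the unit sphere, the Laplace-Beltrami operator is the Euclidean Laplacian of the extension
  that is constant along rays; likewise a function on the sphere is \<open>C\<^sup>2\<close> iff this extension is
  \<open>C\<^sup>2\<close> away from the origin.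
\<close>

definition laplace_beltrami :: "(real ^ 3 \<Rightarrow> complex) \<Rightarrow> real ^ 3 \<Rightarrow> complex" where
  "laplace_beltrami f \<xi> = laplacian (f \<circ> radial_proj) \<xi>"

definition laplace_beltrami_eigenfunction :: "(real ^ 3 \<Rightarrow> complex) \<Rightarrow> bool" where
  "laplace_beltrami_eigenfunction f \<longleftrightarrow>
     C2_on (- {0}) (f \<circ> radial_proj) \<and>
     (\<exists>\<xi>\<in>S2. f \<xi> \<noteq> 0) \<and>
     (\<exists>\<mu>. \<forall>\<xi>\<in>S2. laplace_beltrami f \<xi> = \<mu> * f \<xi>)"


subsection \<open>Expansion coefficients and iterated double series\<close>

definition kernel_coeff ::
    "(real ^ 3 \<Rightarrow> real ^ 3 \<Rightarrow> complex) \<Rightarrow> (nat \<Rightarrow> real ^ 3 \<Rightarrow> complex) \<Rightarrow> nat \<Rightarrow> nat \<Rightarrow> complex" where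
  "kernel_coeff K F l l' =
     (LINT \<zeta>|surface_measure. (LINT \<xi>|surface_measure. K \<xi> \<zeta> * cnj (F l \<xi>) * F l' \<zeta>))"

text \<open>The inner sum is over the first index.\<close>

definition iterated_sums :: "(nat \<Rightarrow> nat \<Rightarrow> complex) \<Rightarrow> complex \<Rightarrow> bool" where
  "iterated_sums f s \<longleftrightarrow>
     (\<forall>l'. summable (\<lambda>l. f l l')) \<and> (\<lambda>l'. \<Sum>l. f l l') sums s"


subsection \<open>Sequences\<close>

global_interpretation cseq: vector_space "\<lambda>(c::complex) (y::nat \<Rightarrow> complex) l. c * y l"
  by standard (auto simp: fun_eq_iff algebra_simps)

definition eval_span :: "(nat \<Rightarrow> real ^ 3 \<Rightarrow> complex) \<Rightarrow> (nat \<Rightarrow> complex) set" where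
  "eval_span F = cseq.span ((\<lambda>\<xi> l. F l \<xi>) ` S2)"

definition seq_inner :: "(nat \<Rightarrow> complex) \<Rightarrow> (nat \<Rightarrow> complex) \<Rightarrow> complex" where
  "seq_inner x y = (\<Sum>l. cnj (x l) * y l)"

definition coeff_op :: "(nat \<Rightarrow> nat \<Rightarrow> complex) \<Rightarrow> (nat \<Rightarrow> complex) \<Rightarrow> nat \<Rightarrow> complex" where
  "coeff_op a y l' = (\<Sum>l. a l l' * y l)"


subsection \<open>Strictly positive definite kernels\<close>

text \<open>Vectors with entries indexed by a finite point set \<open>\<Xi>\<close> are functions restricted to \<open>\<Xi>\<close>.\<close>

definition fin_inner :: "'a set \<Rightarrow> ('a \<Rightarrow> complex) \<Rightarrow> ('a \<Rightarrow> complex) \<Rightarrow> complex" where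
  "fin_inner \<Xi> x y = (\<Sum>\<xi>\<in>\<Xi>. cnj (x \<xi>) * y \<xi>)"

definition kernel_matrix_op ::
    "('a \<Rightarrow> 'a \<Rightarrow> complex) \<Rightarrow> 'a set \<Rightarrow> ('a \<Rightarrow> complex) \<Rightarrow> 'a \<Rightarrow> complex" where
  "kernel_matrix_op K \<Xi> x \<xi> = (\<Sum>\<zeta>\<in>\<Xi>. K \<xi> \<zeta> * x \<zeta>)"

definition strictly_positive_op ::
    "'a set \<Rightarrow> (('a \<Rightarrow> complex) \<Rightarrow> 'a \<Rightarrow> complex) \<Rightarrow> bool" where
  "strictly_positive_op \<Xi> T \<longleftrightarrow>
     (\<forall>x y. fin_inner \<Xi> (T x) y = fin_inner \<Xi> x (T y)) \<and>
     (\<forall>x. (\<exists>\<xi>\<in>\<Xi>. x \<xi> \<noteq> 0) \<longrightarrow> 0 < fin_inner \<Xi> (T x) x)"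

definition strictly_positive_definite :: "(real ^ 3 \<Rightarrow> real ^ 3 \<Rightarrow> complex) \<Rightarrow> bool" where
  "strictly_positive_definite K \<longleftrightarrow>
     (\<forall>\<Xi>. finite \<Xi> \<and> \<Xi> \<subseteq> S2 \<longrightarrow> strictly_positive_op \<Xi> (kernel_matrix_op K \<Xi>))"

end

theory Submission
  imports Defs
begin

text \<open>
  A vector \<open>x\<close> on a finite point set \<open>\<Xi>\<close> and the sequence
  \<open>y = (\<lambda>l. \<Sum>\<xi>\<in>\<Xi>. cnj (x \<xi>) * F l \<xi>)\<close> give the same value in the two quadratic forms: insert the
  expansion of \<open>K\<close> and exchange the finite sums with the series (\<open>quadratic_form_eq_seq_inner\<close>). Every
  element of the span is such a \<open>y\<close>, and \<open>y \<noteq> 0\<close> forces \<open>x \<noteq> 0\<close>, so strict positive definiteness of \<open>K\<close>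
  implies positivity on the span. The converse needs that \<open>x \<noteq> 0\<close> also forces \<open>y \<noteq> 0\<close>: the evaluation
  sequences at distinct points are linearly independent (\<open>evaluations_linearly_independent\<close>). This is
  where the analysis lies.

  Suppose \<open>\<Sum>\<xi>\<in>\<Xi>. c \<xi> * F l \<xi> = 0\<close> for all \<open>l\<close>. The values \<open>F l \<xi>\<close> are recovered from integrals by Green's
  function of the sphere, which up to normalization is \<open>ln (1 - \<xi> \<bullet> \<zeta>)\<close>: if \<open>f\<close> is an eigenfunction
  with eigenvalue \<open>\<mu>\<close>, then
  \<open>4 \<pi> f \<xi> - \<integral> f = \<mu> \<integral> ln (1 - \<xi> \<bullet> \<zeta>) f \<zeta> d\<zeta>\<close> (\<open>log_potential_eigenfunction\<close>). The kernel is the same for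
  all eigenvalues, so the combination \<open>v \<zeta> = \<Sum>\<xi>\<in>\<Xi>. c \<xi> * ln (1 - \<xi> \<bullet> \<zeta>)\<close> inherits the relation: after
  subtraction of its mean it integrates to zero against every \<open>F l\<close>. It is square integrable, so it is
  constant almost everywhere by completeness of the basis. But \<open>v\<close> is unbounded near each point \<open>\<xi>\<close>
  with \<open>c \<xi> \<noteq> 0\<close>, and hence \<open>c = 0\<close>.

  The representation formula is the limit \<open>a \<rightarrow> 1\<close> of Green's identity (\<open>green_zonal\<close>) for the smooth
  profiles \<open>ln (a - t)\<close>, whose Laplace-Beltrami image \<open>(a\<^sup>2 - 1) / (a - t)\<^sup>2 - 1\<close> consists of an approximate
  identity and a constant. The same identity for other profiles supplies the remaining facts:
  the total mass of the kernel, the mean of an eigenfunction, and, from \<open>sqrt (a - t)\<close>, the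
  integrability of the singularity. Green's identity itself is a divergence theorem for tangential
  fields (\<open>integral_tangential_divergence_eq_0\<close>): the surface integral is a volume integral over the ball,
  and there integrals of derivatives vanish by translation invariance of Lebesgue measure.
\<close>

section \<open>Surface integrals as volume integrals\<close>

lemma surface_measure_eq_density:
  "surface_measure =
     density (distr (restrict_space lborel (ball 0 1 - {0})) (restrict_space borel S2) radial_proj)
       (\<lambda>_. ennreal 3)" (is "_ = density ?M _")
proof (rule measure_eqI)
  fix B assume B: "B \<in> sets surface_measure"
  then have "B \<in> sets ?M"
    by (simp add: surface_measure_def)
  then show "emeasure surface_measure B = emeasure (density ?M (\<lambda>_. ennreal 3)) B"
    by (simp add: surface_measure_def emeasure_density_const)
qed (simp add: surface_measure_def)

text \<open>
  The surface measure is three times the image of Lebesgue measure on the punctured ball under radial projection.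
  All integrals over the sphere below are computed as volume integrals of functions that are
  constant along rays, so that only translations of space are needed and no charts of the sphere.
\<close>

lemma integral_surface_measure:
  fixes \<Phi> :: "real ^ 3 \<Rightarrow> 'b :: {banach, second_countable_topology}"
  assumes "\<Phi> \<in> borel_measurable surface_measure"
  shows "(LINT \<xi>|surface_measure. \<Phi> \<xi>) =
    3 *\<^sub>R (LINT x|lborel. indicator (ball 0 1 - {0}) x *\<^sub>R \<Phi> (radial_proj x))"
proof -
  have meas: "\<Phi> \<in> borel_measurable (restrict_space borel S2)"
    using assms by (simp add: measurable_cong_sets[OF sets_surface_measure refl])
  have "(LINT \<xi>|surface_measure. \<Phi> \<xi>) =
    3 *\<^sub>R (LINT x|distr (restrict_space lborel (ball 0 1 - {0})) (restrict_space borel S2) radial_proj. \<Phi> x)"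
    unfolding surface_measure_eq_density using meas
    by (subst integral_density) auto
  also have "\<dots> = 3 *\<^sub>R (LINT x|restrict_space lborel (ball 0 1 - {0}). \<Phi> (radial_proj x))"
    by (subst integral_distr[OF measurable_radial_proj meas]) simp
  also have "\<dots> = 3 *\<^sub>R (LINT x|lborel. indicator (ball 0 1 - {0}) x *\<^sub>R \<Phi> (radial_proj x))"
    by (subst integral_restrict_space) auto
  finally show ?thesis .
qed

section \<open>Integrals of directional derivatives\<close>

lemma integral_translation:
  fixes h :: "'a::euclidean_space \<Rightarrow> complex"
  assumes "h \<in> borel_measurable borel"
  shows "(LINT x|lborel. h (x + c)) = (LINT x|lborel. h x)"
proof -
  have "(LINT x|lborel. h x) = (LINT x|distr lborel borel ((+) c). h x)"
    by (simp only: lborel_distr_plus)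
  also have "\<dots> = (LINT x|lborel. h (c + x))"
    using assms by (subst integral_distr) auto
  finally show ?thesis by (simp add: add.commute)
qed

lemma integrable_continuous_bounded_support:
  fixes h :: "'a::euclidean_space \<Rightarrow> complex"
  assumes "continuous_on UNIV h" and supp: "\<And>x. norm x \<ge> R \<Longrightarrow> h x = 0"
  shows "integrable lborel h"
proof -
  have "integrable lborel (\<lambda>x. indicator (cball 0 R) x *\<^sub>R h x)"
    by (intro borel_integrable_compact continuous_on_subset[OF assms(1)]) auto
  also have "(\<lambda>x. indicator (cball 0 R) x *\<^sub>R h x) = h"
    using supp by (force simp: fun_eq_iff indicator_def)
  finally show ?thesis .
qed

text \<open>
  The integral of \<open>x \<mapsto> h (x + t e)\<close> does not depend on \<open>t\<close>, because Lebesgue measure is invariant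
  under translations; its derivative at \<open>t = 0\<close> is the integral of the directional derivative.
  The differentiation under the integral sign is dominated convergence for difference quotients,
  which a bound of \<open>h'\<close> on the support controls.
\<close>

lemma integral_directional_derivative_eq_0:
  fixes h h' :: "'a::euclidean_space \<Rightarrow> complex"
  assumes der: "\<And>x. ((\<lambda>t. h (x + t *\<^sub>R e)) has_vector_derivative h' x) (at 0)"
    and cont_h: "continuous_on UNIV h" and cont_h': "continuous_on UNIV h'"
    and supp: "\<And>x. norm x \<ge> R \<Longrightarrow> h x = 0"
  shows "(LINT x|lborel. h' x) = 0"
proof -
  have der': "((\<lambda>t. h (x + t *\<^sub>R e)) has_vector_derivative h' (x + s *\<^sub>R e)) (at s)" for x s
  proof -
    have "((\<lambda>t. h ((x + s *\<^sub>R e) + t *\<^sub>R e)) \<circ> (\<lambda>t. t - s) has_vector_derivative 1 *\<^sub>R h' (x + s *\<^sub>R e)) (at s)"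
      by (rule vector_diff_chain_at) (use der in \<open>auto intro!: derivative_eq_intros\<close>)
    then show ?thesis
      by (simp add: o_def algebra_simps)
  qed
  \<comment> \<open>For this the inequality is strict: near such a point \<open>h\<close> vanishes identically.\<close>
  have supp': "h' x = 0" if x: "norm x > R" for x
  proof -
    have "isCont (\<lambda>t. norm (x + t *\<^sub>R e)) 0"
      by (intro continuous_intros)
    then have "\<forall>\<^sub>F t in at 0. norm (x + t *\<^sub>R e) > R"
      unfolding isCont_def by (rule order_tendstoD(1)) (use x in simp)
    then have "\<forall>\<^sub>F t in nhds 0. h (x + t *\<^sub>R e) = 0"
      unfolding eventually_at_filter
    proof eventually_elim
      case (elim t)
      then show ?case
        using x by (cases "t = 0") (auto intro!: supp)
    qed
    then have "((\<lambda>t. h (x + t *\<^sub>R e)) has_vector_derivative 0) (at 0)"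
      by (subst has_vector_derivative_cong_ev[where g = "\<lambda>_. 0"]) (use x supp in auto)
    with der[of x] show ?thesis
      by (rule vector_derivative_unique_at)
  qed
  have "bounded (h' ` cball 0 R)"
    by (intro compact_imp_bounded compact_continuous_image continuous_on_subset[OF cont_h']) auto
  then obtain B0 where "\<forall>y \<in> h' ` cball 0 R. norm y \<le> B0"
    unfolding bounded_iff by blast
  then have B0: "norm (h' x) \<le> B0" if "x \<in> cball 0 R" for x
    using that by blast
  define B where "B = max 0 B0"
  have B: "norm (h' x) \<le> B" for x
    using B0[of x] supp'[of x] unfolding B_def by (cases "norm x \<le> R") auto
  have B_pos: "0 \<le> B" by (simp add: B_def)
  have lip: "norm (h (x + t *\<^sub>R e) - h x) \<le> B * \<bar>t\<bar>" for x t
  proof -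
    have "norm (h (x + t *\<^sub>R e) - h (x + 0 *\<^sub>R e)) \<le> B * norm (t - 0)"
    proof (rule differentiable_bound[where S = UNIV and f = "\<lambda>t. h (x + t *\<^sub>R e)"])
      show "((\<lambda>t. h (x + t *\<^sub>R e)) has_derivative (\<lambda>r. r *\<^sub>R h' (x + s *\<^sub>R e))) (at s)" for s
        using der'[of x s] by (simp add: has_vector_derivative_def)
      show "onorm (\<lambda>r. r *\<^sub>R h' (x + s *\<^sub>R e)) \<le> B" for s
        by (rule onorm_bound) (simp_all add: mult.commute[of B] mult_left_mono B B_pos)
    qed auto
    then show ?thesis by simp
  qed
  have meas: "h \<in> borel_measurable borel" "h' \<in> borel_measurable borel"
    using cont_h cont_h' by (auto intro: borel_measurable_continuous_onI)
  define t :: "nat \<Rightarrow> real" where "t = (\<lambda>n. inverse (real (Suc n)))"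
  have t: "0 < t n" "t n \<le> 1" for n
    by (auto simp: t_def field_simps)
  define q where "q = (\<lambda>n x. (h (x + t n *\<^sub>R e) - h x) /\<^sub>R t n)"
  have int_h: "integrable lborel h"
    using cont_h supp by (rule integrable_continuous_bounded_support)
  have int_shift: "integrable lborel (\<lambda>x. h (x + c))" for c
  proof -
    have "integrable (distr lborel borel ((+) c)) h"
      using int_h by (simp only: lborel_distr_plus)
    then show ?thesis
      using meas by (subst (asm) integrable_distr_eq) (auto simp: add.commute)
  qed
  have "(\<lambda>n. LINT x|lborel. q n x) \<longlonglongrightarrow> (LINT x|lborel. h' x)"
  proof (rule integral_dominated_convergence[where w = "\<lambda>x. B * indicator (cball 0 (R + norm e)) x"])
    show "h' \<in> borel_measurable lborel" "q n \<in> borel_measurable lborel" for n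
      using meas by (auto simp: q_def)
    show "integrable lborel (\<lambda>x. B * indicator (cball 0 (R + norm e)) x :: real)"
      by (intro integrable_mult_right integrable_real_indicator emeasure_lborel_cball_finite) simp
    show "AE x in lborel. (\<lambda>n. q n x) \<longlonglongrightarrow> h' x"
    proof (rule AE_I2)
      fix x
      have "((\<lambda>s. norm (h (x + (0 + s) *\<^sub>R e) - h (x + 0 *\<^sub>R e) - s *\<^sub>R h' x) / norm s) \<longlongrightarrow> 0) (at 0)"
        using der[of x] unfolding has_vector_derivative_def has_derivative_at by blast
      moreover have "filterlim t (at 0) sequentially"
        unfolding filterlim_at using LIMSEQ_inverse_real_of_nat t(1)
        by (auto simp: t_def)
      ultimately have "(\<lambda>n. norm (h (x + (0 + t n) *\<^sub>R e) - h (x + 0 *\<^sub>R e) - t n *\<^sub>R h' x) / norm (t n)) \<longlonglongrightarrow> 0"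
        by (rule filterlim_compose)
      also have "(\<lambda>n. norm (h (x + (0 + t n) *\<^sub>R e) - h (x + 0 *\<^sub>R e) - t n *\<^sub>R h' x) / norm (t n))
          = (\<lambda>n. norm (q n x - h' x))"
      proof
        fix n
        have "q n x - h' x = (h (x + (0 + t n) *\<^sub>R e) - h (x + 0 *\<^sub>R e) - t n *\<^sub>R h' x) /\<^sub>R t n"
          using t(1)[of n] by (simp add: q_def algebra_simps)
        then show "norm (h (x + (0 + t n) *\<^sub>R e) - h (x + 0 *\<^sub>R e) - t n *\<^sub>R h' x) / norm (t n) = norm (q n x - h' x)"
          using t(1)[of n] by (simp add: divide_inverse mult.commute)
      qed
      finally show "(\<lambda>n. q n x) \<longlonglongrightarrow> h' x"
        using LIM_zero_cancel tendsto_norm_zero_iff by blast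
    qed
    show "AE x in lborel. norm (q n x) \<le> B * indicator (cball 0 (R + norm e)) x" for n
    proof (rule AE_I2)
      fix x
      have "q n x = 0" if "norm x > R + norm e"
      proof -
        have "norm (t n *\<^sub>R e) \<le> norm e"
          using t[of n] by (simp add: mult_left_le_one_le)
        moreover have "norm x \<le> norm (x + t n *\<^sub>R e) + norm (t n *\<^sub>R e)"
          using norm_triangle_ineq4[of "x + t n *\<^sub>R e" "t n *\<^sub>R e"] by simp
        ultimately have "h (x + t n *\<^sub>R e) = 0" "h x = 0"
          using that by (auto intro!: supp simp del: norm_scaleR) (use norm_ge_zero[of e] in linarith)
        then show ?thesis by (simp add: q_def)
      qed
      moreover have "norm (q n x) \<le> B"
        using lip[of x "t n"] t(1)[of n] by (simp add: q_def divide_simps mult.commute)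
      ultimately show "norm (q n x) \<le> B * indicator (cball 0 (R + norm e)) x"
        using B_pos by (cases "norm x \<le> R + norm e") (auto simp: indicator_def)
    qed
  qed
  moreover have "(LINT x|lborel. q n x) = 0" for n
    using int_h int_shift integral_translation[OF meas(1)] by (simp add: q_def)
  ultimately show ?thesis
    by (simp add: LIMSEQ_const_iff)
qed

section \<open>The divergence theorem on the sphere\<close>

lemma borel_measurable_surface_measure_continuous:
  assumes "continuous_on S2 \<Phi>"
  shows "\<Phi> \<in> borel_measurable surface_measure"
  using borel_measurable_continuous_on_restrict[OF assms]
  by (simp add: measurable_cong_sets[OF sets_surface_measure refl])

lemma radial_proj_in_S2: "x \<noteq> 0 \<Longrightarrow> radial_proj x \<in> S2"
  by (simp add: radial_proj_def)

lemma radial_proj_S2: "x \<in> S2 \<Longrightarrow> radial_proj x = x"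
  by (simp add: radial_proj_def)

lemma radial_proj_scaleR: "c > 0 \<Longrightarrow> radial_proj (c *\<^sub>R x) = radial_proj x"
  by (simp add: radial_proj_def)

lemma continuous_on_radial_proj: "continuous_on (- {0}) radial_proj"
  unfolding radial_proj_def by (intro continuous_intros) auto

text \<open>
  A \<open>C\<^sup>1\<close> function that vanishes on the negative half-line and tends to \<open>1\<close> at infinity, from which
  the cutoff functions below are composed.
\<close>

definition unit_step :: "real \<Rightarrow> real" where
  "unit_step s = (max 0 s)\<^sup>2 / (1 + (max 0 s)\<^sup>2)"

definition unit_step' :: "real \<Rightarrow> real" where
  "unit_step' s = 2 * max 0 s / (1 + (max 0 s)\<^sup>2)\<^sup>2"

lemma unit_step_denominator: "1 + (max 0 s)\<^sup>2 \<noteq> (0::real)"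
  using zero_le_power2[of "max 0 s"] by linarith

lemma unit_step_has_derivative: "(unit_step has_real_derivative unit_step' s) (at s)"
proof -
  have "((\<lambda>s. (max 0 s)\<^sup>2) has_real_derivative 2 * max 0 s) (at s)"
  proof -
    consider "s > 0" | "s < 0" | "s = 0" by linarith
    then show ?thesis
    proof cases
      case 1
      have "((\<lambda>s. s\<^sup>2) has_real_derivative 2 * s) (at s)"
        by (auto intro!: derivative_eq_intros)
      then have "((\<lambda>s. (max 0 s)\<^sup>2) has_real_derivative 2 * s) (at s)"
        by (rule has_field_derivative_transform_within_open[where S = "{0<..}"]) (use 1 in auto)
      with 1 show ?thesis by simp
    next
      case 2
      have "((\<lambda>s. 0) has_real_derivative 0) (at s)"
        by simp
      then have "((\<lambda>s. (max 0 s)\<^sup>2) has_real_derivative 0) (at s)"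
        by (rule has_field_derivative_transform_within_open[where S = "{..<0}"]) (use 2 in auto)
      with 2 show ?thesis by simp
    next
      case 3
      have "((\<lambda>y. max 0 y) \<longlongrightarrow> max 0 0) (at (0::real))"
        by (intro tendsto_intros)
      moreover have "(max 0 y)\<^sup>2 / y = max 0 y" for y :: real
        by (auto simp: max_def power2_eq_square)
      ultimately show ?thesis
        using 3 by (simp add: has_field_derivative_iff)
    qed
  qed
  from DERIV_divide[OF this DERIV_add[OF DERIV_const[of 1] this] unit_step_denominator]
  show ?thesis
    unfolding unit_step_def[abs_def] unit_step'_def
    by (simp add: power2_eq_square algebra_simps)
qed

lemma unit_step_nonpos: "s \<le> 0 \<Longrightarrow> unit_step s = 0" "s \<le> 0 \<Longrightarrow> unit_step' s = 0"
  by (auto simp: unit_step_def unit_step'_def max_def)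

lemma unit_step_bounds: "0 \<le> unit_step s" "unit_step s \<le> 1"
  using add_pos_nonneg[OF zero_less_one zero_le_power2[of "max 0 s"]]
  by (auto simp: unit_step_def divide_simps)

lemma continuous_on_unit_step:
  "continuous_on A unit_step" "continuous_on A unit_step'"
proof -
  show "continuous_on A unit_step"
    using unit_step_has_derivative DERIV_continuous_on has_field_derivative_at_within by blast
  show "continuous_on A unit_step'"
    unfolding unit_step'_def[abs_def]
    by (intro continuous_intros ballI) (simp add: unit_step_denominator)
qed

lemma unit_step_tendsto: "(unit_step \<longlongrightarrow> 1) at_top"
proof -
  have "filterlim (\<lambda>s. 1 + s\<^sup>2) at_top (at_top :: real filter)"
    by (intro filterlim_tendsto_add_at_top[OF tendsto_const] filterlim_pow_at_top filterlim_ident) auto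
  then have "((\<lambda>s::real. 1 - inverse (1 + s\<^sup>2)) \<longlongrightarrow> 1 - 0) at_top"
    by (intro tendsto_intros tendsto_inverse_0_at_top)
  moreover have "\<forall>\<^sub>F s in at_top. 1 - inverse (1 + s\<^sup>2) = unit_step s"
    using eventually_ge_at_top[of 0]
  proof eventually_elim
    case (elim s)
    then show ?case
      using unit_step_denominator[of s] by (simp add: unit_step_def field_simps)
  qed
  ultimately show ?thesis
    by (simp add: tendsto_cong)
qed

lemma coordinate_line_has_derivative:
  fixes x \<xi> :: "real ^ 3"
  shows "((\<lambda>t. (x + t *\<^sub>R axis i 1) $ i) has_real_derivative 1) (at 0)"
    and "((\<lambda>t. \<xi> \<bullet> (x + t *\<^sub>R axis i 1)) has_real_derivative \<xi> $ i) (at 0)"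
    and "((\<lambda>t. (x + t *\<^sub>R axis i 1) \<bullet> (x + t *\<^sub>R axis i 1)) has_real_derivative 2 * x $ i) (at 0)"
proof -
  show "((\<lambda>t. (x + t *\<^sub>R axis i 1) $ i) has_real_derivative 1) (at 0)"
    by (auto intro!: derivative_eq_intros)
  show "((\<lambda>t. \<xi> \<bullet> (x + t *\<^sub>R axis i 1)) has_real_derivative \<xi> $ i) (at 0)"
    by (auto intro!: derivative_eq_intros simp: inner_add_right inner_axis)
  have "(x + t *\<^sub>R axis i 1) \<bullet> (x + t *\<^sub>R axis i 1) = x \<bullet> x + 2 * t * x $ i + t\<^sup>2" for t
    by (simp add: inner_add_left inner_add_right inner_axis inner_axis' power2_eq_square algebra_simps)
  then show "((\<lambda>t. (x + t *\<^sub>R axis i 1) \<bullet> (x + t *\<^sub>R axis i 1)) has_real_derivative 2 * x $ i) (at 0)"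
    by (auto intro!: derivative_eq_intros)
qed

lemma norm_line_has_derivative:
  fixes x :: "real ^ 3"
  assumes "x \<noteq> 0"
  shows "((\<lambda>t. norm (x + t *\<^sub>R axis i 1)) has_real_derivative x $ i / norm x) (at 0)"
proof -
  have "x \<bullet> x > 0" using assms by simp
  then have "(sqrt has_real_derivative inverse (sqrt (x \<bullet> x)) / 2) (at ((x + 0 *\<^sub>R axis i 1) \<bullet> (x + 0 *\<^sub>R axis i 1)))"
    by (auto intro: DERIV_real_sqrt)
  from DERIV_chain2[where f = sqrt and g = "\<lambda>t. (x + t *\<^sub>R axis i 1) \<bullet> (x + t *\<^sub>R axis i 1)",
      OF this coordinate_line_has_derivative(3)[of x i]]
  have "((\<lambda>t. sqrt ((x + t *\<^sub>R axis i 1) \<bullet> (x + t *\<^sub>R axis i 1))) has_real_derivative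
      inverse (sqrt (x \<bullet> x)) / 2 * (2 * x $ i)) (at 0)" .
  moreover have "inverse a / 2 * (2 * b) = b / a" for a b :: real
    by (simp add: field_simps)
  ultimately show ?thesis
    by (simp only: norm_eq_sqrt_inner)
qed

text \<open>
  The fields below are built from functions that are constant along rays, which have no continuous
  extension to the origin in general; multiplication by a cutoff that vanishes near the origin repairs
  this.
\<close>

lemma continuous_on_UNIV_cutoff:
  fixes h :: "'a::real_normed_vector \<Rightarrow> 'b::real_normed_vector"
  assumes "continuous_on (- {0}) h" and "\<And>x. norm x < r \<Longrightarrow> h x = 0" and "0 < r"
  shows "continuous_on UNIV h"
proof -
  have "continuous_on (ball 0 r) h"
    by (rule continuous_on_eq[OF continuous_on_const[of "ball 0 r" 0]]) (simp add: assms(2))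
  then have "continuous_on (- {0} \<union> ball 0 r) h"
    using assms(1) by (intro continuous_on_open_Un) auto
  moreover have "- {0} \<union> ball 0 r = (UNIV :: 'a set)"
    using assms(3) by auto
  ultimately show ?thesis by (simp only:)
qed

text \<open>
  The divergence theorem on the sphere. Let \<open>\<psi>\<^sub>n\<close> be a radial \<open>C\<^sup>1\<close> function with support in the shell
  \<open>1 / (n + 1) \<le> \<bar>x\<bar>\<^sup>2 \<le> 1\<close>. The field \<open>\<psi>\<^sub>n W\<close> has compact support, so the integral of its divergence
  is zero. Since \<open>W\<close> is tangential to the spheres about the origin and the gradient of \<open>\<psi>\<^sub>n\<close> is radial,
  this divergence is just \<open>\<psi>\<^sub>n\<close> times the divergence of \<open>W\<close>. As \<open>n\<close> grows, \<open>\<psi>\<^sub>n\<close> tends to the indicator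
  function of the punctured ball, on which the volume integral is a third of the surface integral.
\<close>

lemma integral_tangential_divergence_eq_0:
  fixes W D :: "3 \<Rightarrow> real ^ 3 \<Rightarrow> complex" and \<Phi> :: "real ^ 3 \<Rightarrow> complex"
  assumes der: "\<And>i x. x \<noteq> 0 \<Longrightarrow>
      ((\<lambda>t. W i (x + t *\<^sub>R axis i 1)) has_vector_derivative D i x) (at 0)"
    and cont_W: "\<And>i. continuous_on (- {0}) (W i)"
    and cont_D: "\<And>i. continuous_on (- {0}) (D i)"
    and tangential: "\<And>x. x \<noteq> 0 \<Longrightarrow> (\<Sum>i\<in>UNIV. x $ i *\<^sub>R W i x) = 0"
    and div: "\<And>x. x \<noteq> 0 \<Longrightarrow> (\<Sum>i\<in>UNIV. D i x) = \<Phi> (radial_proj x)"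
    and cont_\<Phi>: "continuous_on S2 \<Phi>"
  shows "(LINT \<xi>|surface_measure. \<Phi> \<xi>) = 0"
proof -
  \<comment> \<open>\<open>p n\<close> is positive exactly in the open shell and tends to infinity there; writing it in \<open>x \<bullet> x\<close> keeps it polynomial.\<close>
  define p where "p = (\<lambda>n x::real^3. (1 - x \<bullet> x) * (real (Suc n) * (x \<bullet> x) - 1))"
  define p' where "p' = (\<lambda>n x::real^3. 2 * (real (Suc n) * (1 - x \<bullet> x) - (real (Suc n) * (x \<bullet> x) - 1)))"
  define \<psi> where "\<psi> = (\<lambda>n x. unit_step (p n x))"
  define h where "h = (\<lambda>n i x. \<psi> n x *\<^sub>R W i x)"
  define h' where "h' = (\<lambda>n i x. \<psi> n x *\<^sub>R D i x + (unit_step' (p n x) * (x $ i * p' n x)) *\<^sub>R W i x)"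
  have p_outer: "p n x \<le> 0" if "norm x \<ge> 1" for n x
  proof -
    have "x \<bullet> x \<ge> 1" using that by (simp add: dot_square_norm)
    moreover from this have "real (Suc n) * (x \<bullet> x) \<ge> 1 * 1"
      by (intro mult_mono) auto
    ultimately show ?thesis unfolding p_def
      by (intro mult_nonpos_nonneg) auto
  qed
  have p_inner: "p n x \<le> 0" if "norm x < 1 / real (Suc n)" for n x
  proof -
    have "1 / real (Suc n) \<le> 1" by simp
    with that have *: "norm x < 1" by linarith
    have "x \<bullet> x = norm x * norm x" by (simp add: dot_square_norm power2_eq_square)
    also have "\<dots> \<le> 1 / real (Suc n) * 1"
      using that * by (intro mult_mono) auto
    finally have "real (Suc n) * (x \<bullet> x) \<le> 1"
      by (simp add: field_simps)
    moreover have "x \<bullet> x \<le> 1"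
      using * by (simp add: dot_square_norm power_le_one)
    ultimately show ?thesis unfolding p_def
      by (intro mult_nonneg_nonpos) auto
  qed
  have zero: "h n i x = 0" "h' n i x = 0" if "norm x < 1 / real (Suc n) \<or> norm x \<ge> 1" for n i x
  proof -
    have "p n x \<le> 0"
      using that p_inner p_outer by blast
    then show "h n i x = 0" "h' n i x = 0"
      by (simp_all add: h_def h'_def \<psi>_def unit_step_nonpos)
  qed
  have cont_p: "continuous_on A (p n)" "continuous_on A (p' n)" for A n
    unfolding p_def p'_def by (intro continuous_intros)+
  have cont_unit_step: "continuous_on A (\<lambda>x. unit_step (p n x))" "continuous_on A (\<lambda>x. unit_step' (p n x))" for A n
    by (rule continuous_on_compose2[OF continuous_on_unit_step(1)[of UNIV] cont_p(1)], simp)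
       (rule continuous_on_compose2[OF continuous_on_unit_step(2)[of UNIV] cont_p(1)], simp)
  have cont_h: "continuous_on UNIV (h n i)" for n i
  proof (rule continuous_on_UNIV_cutoff[where r = "1 / real (Suc n)"])
    show "continuous_on (- {0}) (h n i)"
      unfolding h_def \<psi>_def by (intro continuous_intros cont_unit_step cont_W)
  qed (simp_all add: zero del: of_nat_Suc)
  have cont_h': "continuous_on UNIV (h' n i)" for n i
  proof (rule continuous_on_UNIV_cutoff[where r = "1 / real (Suc n)"])
    show "continuous_on (- {0}) (h' n i)"
      unfolding h'_def \<psi>_def
      by (intro continuous_intros cont_unit_step cont_W cont_D cont_p)
  qed (simp_all add: zero del: of_nat_Suc)
  have der_h: "((\<lambda>t. h n i (x + t *\<^sub>R axis i 1)) has_vector_derivative h' n i x) (at 0)" for n i x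
  proof (cases "x = 0")
    case True
    have "((\<lambda>t::real. 0::complex) has_vector_derivative 0) (at 0)"
      by simp
    then have "((\<lambda>t. h n i (t *\<^sub>R axis i 1)) has_vector_derivative 0) (at 0)"
      by (rule has_vector_derivative_transform_within_open[where S = "ball 0 (1 / real (Suc n))"])
         (auto simp: zero simp del: of_nat_Suc)
    then show ?thesis using True by (simp add: zero)
  next
    case False
    have "((\<lambda>t. p n (x + t *\<^sub>R axis i 1)) has_real_derivative x $ i * p' n x) (at 0)"
      unfolding p_def p'_def
      by (rule derivative_eq_intros coordinate_line_has_derivative refl)+ (simp add: algebra_simps)
    moreover have "(unit_step has_real_derivative unit_step' (p n x)) (at (p n (x + 0 *\<^sub>R axis i 1)))"
      using unit_step_has_derivative by simp
    ultimately have "((\<lambda>t. \<psi> n (x + t *\<^sub>R axis i 1)) has_real_derivative unit_step' (p n x) * (x $ i * p' n x)) (at 0)"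
      unfolding \<psi>_def by (rule DERIV_chain2[rotated])
    from has_vector_derivative_scaleR[OF this der[OF False, of i]]
    show ?thesis by (simp add: h_def h'_def)
  qed
  have int_h': "(LINT x|lborel. h' n i x) = 0" for n i
    by (rule integral_directional_derivative_eq_0[OF der_h cont_h cont_h', where R = 1])
       (simp add: zero)
  have integrable_h': "integrable lborel (h' n i)" for n i
    by (rule integrable_continuous_bounded_support[OF cont_h', where R = 1]) (simp add: zero)
  have sum_h': "(\<Sum>i\<in>UNIV. h' n i x) = \<psi> n x *\<^sub>R \<Phi> (radial_proj x)" for n x
  proof (cases "x = 0")
    case True
    then show ?thesis by (simp add: zero \<psi>_def unit_step_nonpos p_inner del: of_nat_Suc)
  next
    case False
    have "(\<Sum>i\<in>UNIV. h' n i x) = \<psi> n x *\<^sub>R (\<Sum>i\<in>UNIV. D i x)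
        + (unit_step' (p n x) * p' n x) *\<^sub>R (\<Sum>i\<in>UNIV. x $ i *\<^sub>R W i x)"
      by (simp add: h'_def sum.distrib scaleR_sum_right ac_simps)
    then show ?thesis using False by (simp add: div tangential)
  qed
  have int_\<psi>: "(LINT x|lborel. \<psi> n x *\<^sub>R \<Phi> (radial_proj x)) = 0" for n
    using integrable_h' by (simp add: sum_h'[symmetric] int_h')
  have meas: "(\<lambda>x. \<psi> n x *\<^sub>R \<Phi> (radial_proj x)) \<in> borel_measurable lborel" for n
    unfolding sum_h'[symmetric] using integrable_h' by (intro borel_measurable_sum) auto
  have lim: "(\<lambda>n. \<psi> n x *\<^sub>R \<Phi> (radial_proj x)) \<longlonglongrightarrow> indicator (ball 0 1 - {0}) x *\<^sub>R \<Phi> (radial_proj x)" for x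
  proof (cases "x \<in> ball 0 1 - {0}")
    case True
    then have pos: "0 < x \<bullet> x" "0 < 1 - x \<bullet> x"
      by (auto simp: dot_square_norm power_less_one_iff abs_square_less_1)
    have "filterlim (\<lambda>n. real (Suc n)) at_top sequentially"
      by (rule filterlim_compose[OF filterlim_real_sequentially filterlim_Suc])
    from filterlim_tendsto_pos_mult_at_top[OF tendsto_const pos(1) this]
    have "filterlim (\<lambda>n. real (Suc n) * (x \<bullet> x)) at_top sequentially"
      by (simp add: mult.commute)
    from filterlim_tendsto_add_at_top[OF tendsto_const[of "-1"] this]
    have "filterlim (\<lambda>n. real (Suc n) * (x \<bullet> x) - 1) at_top sequentially"
      by (simp add: add.commute)
    from filterlim_tendsto_pos_mult_at_top[OF tendsto_const pos(2) this]
    have "filterlim (\<lambda>n. p n x) at_top sequentially"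
      by (simp add: p_def)
    then have "(\<lambda>n. \<psi> n x) \<longlonglongrightarrow> 1"
      unfolding \<psi>_def by (rule filterlim_compose[OF unit_step_tendsto])
    then have "(\<lambda>n. \<psi> n x *\<^sub>R \<Phi> (radial_proj x)) \<longlonglongrightarrow> 1 *\<^sub>R \<Phi> (radial_proj x)"
      by (intro tendsto_intros)
    with True show ?thesis by simp
  next
    case False
    then have "\<psi> n x = 0" for n
      using p_inner[of x n] p_outer[of x n] by (auto simp: \<psi>_def unit_step_nonpos)
    with False show ?thesis by simp
  qed
  have "bounded (\<Phi> ` S2)"
    by (intro compact_imp_bounded compact_continuous_image cont_\<Phi>) auto
  then obtain B where "\<forall>y \<in> \<Phi> ` S2. norm y \<le> B"
    unfolding bounded_iff by blast
  then have B: "norm (\<Phi> \<zeta>) \<le> B" if "\<zeta> \<in> S2" for \<zeta>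
    using that by blast
  have "(\<lambda>n. LINT x|lborel. \<psi> n x *\<^sub>R \<Phi> (radial_proj x)) \<longlonglongrightarrow>
      (LINT x|lborel. indicator (ball 0 1 - {0}) x *\<^sub>R \<Phi> (radial_proj x))"
  proof (rule integral_dominated_convergence[where w = "\<lambda>x. B * indicator (cball 0 1) x"])
    show "(\<lambda>x. indicator (ball 0 1 - {0}) x *\<^sub>R \<Phi> (radial_proj x)) \<in> borel_measurable lborel"
      by (rule borel_measurable_LIMSEQ_metric[OF meas lim])
    show "integrable lborel (\<lambda>x::real^3. B * indicator (cball 0 1) x)"
      by (intro integrable_mult_right integrable_real_indicator emeasure_lborel_cball_finite) simp
    show "AE x in lborel. norm (\<psi> n x *\<^sub>R \<Phi> (radial_proj x)) \<le> B * indicator (cball 0 1) x" for n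
    proof (rule AE_I2)
      fix x
      show "norm (\<psi> n x *\<^sub>R \<Phi> (radial_proj x)) \<le> B * indicator (cball 0 1) x"
      proof (cases "norm x < 1 \<and> x \<noteq> 0")
        case True
        have "\<bar>\<psi> n x\<bar> * norm (\<Phi> (radial_proj x)) \<le> 1 * B"
          using True radial_proj_in_S2[of x]
          by (intro mult_mono B) (simp_all add: \<psi>_def unit_step_bounds)
        with True show ?thesis by simp
      next
        case False
        then have "\<psi> n x = 0"
          using p_inner[of x n] p_outer[of x n] by (auto simp: \<psi>_def unit_step_nonpos)
        moreover have "0 \<le> B"
          using order_trans[OF norm_ge_zero B[of "axis 1 1"]] by simp
        ultimately show ?thesis by simp
      qed
    qed
    show "AE x in lborel. (\<lambda>n. \<psi> n x *\<^sub>R \<Phi> (radial_proj x)) \<longlonglongrightarrow> indicator (ball 0 1 - {0}) x *\<^sub>R \<Phi> (radial_proj x)"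
      by (intro AE_I2 lim)
  qed (rule meas)
  then have "(LINT x|lborel. indicator (ball 0 1 - {0}) x *\<^sub>R \<Phi> (radial_proj x)) = 0"
    by (simp add: int_\<psi> LIMSEQ_const_iff)
  then show ?thesis
    by (simp add: integral_surface_measure borel_measurable_surface_measure_continuous[OF cont_\<Phi>])
qed

section \<open>Functions that are constant along rays\<close>

lemma has_vector_derivative_partial_deriv:
  assumes "g differentiable at x"
  shows "((\<lambda>t. g (x + t *\<^sub>R axis i 1)) has_vector_derivative partial_deriv i g x) (at 0)"
proof -
  have D: "(g has_derivative frechet_derivative g (at x)) (at (x + 0 *\<^sub>R axis i 1))"
    using assms by (simp add: frechet_derivative_works)
  have L: "((\<lambda>t. x + t *\<^sub>R axis i 1) has_derivative (\<lambda>t. t *\<^sub>R axis i 1)) (at 0)"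
    by (auto intro!: derivative_eq_intros)
  have "linear (frechet_derivative g (at x))"
    using assms by (rule linear_frechet_derivative)
  then have lin: "frechet_derivative g (at x) (t *\<^sub>R axis i 1) = t *\<^sub>R partial_deriv i g x" for t
    by (simp add: linear_cmul partial_deriv_def)
  show ?thesis
    using has_derivative_compose[OF L D] by (simp add: has_vector_derivative_def lin)
qed

text \<open>
  Differentiation lowers the degree of homogeneity by one. Here \<open>a\<close> is the factor by which \<open>v\<close> scales
  for the one dilation by \<open>c\<close>, so that the lemma applies to \<open>v\<close> and again to its partial derivatives.
\<close>

lemma partial_deriv_homogeneous:
  assumes c: "c > 0" and x: "x \<noteq> 0"
    and hom: "\<And>y. y \<noteq> 0 \<Longrightarrow> v (c *\<^sub>R y) = a *\<^sub>R v y"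
    and diff: "v differentiable at x"
  shows "partial_deriv i v (c *\<^sub>R x) = (a / c) *\<^sub>R partial_deriv i v x"
proof -
  let ?v' = "frechet_derivative v (at x)"
  have D: "(v has_derivative ?v') (at ((c *\<^sub>R x) /\<^sub>R c))"
    using diff c by (simp add: frechet_derivative_works)
  have L: "((\<lambda>y. y /\<^sub>R c) has_derivative (\<lambda>h. h /\<^sub>R c)) (at (c *\<^sub>R x))"
    by (auto intro!: derivative_eq_intros)
  have "((\<lambda>y. a *\<^sub>R v (y /\<^sub>R c)) has_derivative (\<lambda>h. a *\<^sub>R ?v' (h /\<^sub>R c))) (at (c *\<^sub>R x))"
    by (rule has_derivative_scaleR_right[OF has_derivative_compose[OF L D]])
  then have "(v has_derivative (\<lambda>h. a *\<^sub>R ?v' (h /\<^sub>R c))) (at (c *\<^sub>R x))"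
  proof (rule has_derivative_transform_within_open[where s = "- {0}"])
    fix y :: "real ^ 3" assume "y \<in> - {0}"
    then have "y /\<^sub>R c \<noteq> 0" using c by simp
    from hom[OF this] show "a *\<^sub>R v (y /\<^sub>R c) = v y"
      using c by simp
  qed (use x c in auto)
  from frechet_derivative_at[OF this, symmetric]
  have "partial_deriv i v (c *\<^sub>R x) = a *\<^sub>R ?v' (axis i 1 /\<^sub>R c)"
    by (simp add: partial_deriv_def)
  also have "?v' (axis i 1 /\<^sub>R c) = partial_deriv i v x /\<^sub>R c"
    unfolding partial_deriv_def by (rule linear_cmul[OF linear_frechet_derivative[OF diff]])
  finally show ?thesis by (simp add: divide_inverse)
qed

text \<open>
  A function constant along rays is homogeneous of degree \<open>0\<close>, so its Laplacian is homogeneous of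
  degree \<open>-2\<close>. This carries the eigenvalue equation from the sphere to all of punctured space.
\<close>

lemma laplacian_radial_extension:
  assumes C2: "C2_on (- {0}) (f \<circ> radial_proj)" and x: "x \<noteq> 0"
  shows "(x \<bullet> x) *\<^sub>R laplacian (f \<circ> radial_proj) x = laplace_beltrami f (radial_proj x)"
proof -
  let ?u = "f \<circ> radial_proj" and ?\<xi> = "radial_proj x"
  have \<xi>: "?\<xi> \<noteq> 0" and xn: "x = norm x *\<^sub>R ?\<xi>" and n: "norm x > 0"
    using x by (auto simp: radial_proj_def)
  have first: "partial_deriv i ?u (norm x *\<^sub>R y) = (1 / norm x) *\<^sub>R partial_deriv i ?u y" if "y \<noteq> 0" for i y
    by (rule partial_deriv_homogeneous[OF n that])
       (use C2 that n in \<open>auto simp: C2_on_def radial_proj_scaleR\<close>)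
  have second: "partial_deriv i (partial_deriv i ?u) (norm x *\<^sub>R ?\<xi>) =
      (1 / norm x / norm x) *\<^sub>R partial_deriv i (partial_deriv i ?u) ?\<xi>" for i
    by (rule partial_deriv_homogeneous[OF n \<xi>])
       (use C2 first \<xi> in \<open>auto simp: C2_on_def\<close>)
  have "laplacian ?u x = (1 / norm x / norm x) *\<^sub>R laplacian ?u ?\<xi>"
    by (subst xn) (simp only: laplacian_def second scaleR_sum_right)
  then show ?thesis
    using n by (simp add: laplace_beltrami_def dot_square_norm power2_eq_square)
qed

text \<open>
  Euler's identity in degree \<open>0\<close>: the gradient of a function constant along rays is tangential.
\<close>

lemma radial_extension_euler:
  assumes diff: "(f \<circ> radial_proj) differentiable at x" and x: "x \<noteq> 0"
  shows "(\<Sum>i\<in>UNIV. x $ i *\<^sub>R partial_deriv i (f \<circ> radial_proj) x) = 0"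
proof -
  let ?u = "f \<circ> radial_proj"
  let ?u' = "frechet_derivative ?u (at x)"
  have lin: "linear ?u'" by (rule linear_frechet_derivative[OF diff])
  have "(\<Sum>i\<in>UNIV. x $ i *\<^sub>R partial_deriv i ?u x) = ?u' (\<Sum>i\<in>UNIV. x $ i *\<^sub>R axis i 1)"
    by (simp only: linear_sum[OF lin] linear_cmul[OF lin] partial_deriv_def)
  also have "(\<Sum>i\<in>UNIV. x $ i *\<^sub>R axis i 1) = x"
    using basis_expansion[of x] by (simp add: scalar_mult_eq_scaleR)
  also have "?u' x = 0"
  proof -
    have D: "(?u has_derivative ?u') (at (x + 0 *\<^sub>R x))"
      using diff by (simp add: frechet_derivative_works)
    have L: "((\<lambda>t. x + t *\<^sub>R x) has_derivative (\<lambda>t. t *\<^sub>R x)) (at 0)"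
      by (auto intro!: derivative_eq_intros)
    have 1: "((\<lambda>t. ?u (x + t *\<^sub>R x)) has_vector_derivative ?u' x) (at 0)"
      using has_derivative_compose[OF L D] by (simp add: has_vector_derivative_def linear_cmul[OF lin])
    have "((\<lambda>t::real. ?u x) has_vector_derivative 0) (at 0)"
      by simp
    then have 2: "((\<lambda>t. ?u (x + t *\<^sub>R x)) has_vector_derivative 0) (at 0)"
    proof (rule has_vector_derivative_transform_within_open[where S = "{-1<..}"])
      fix t :: real assume "t \<in> {-1<..}"
      then have "radial_proj ((1 + t) *\<^sub>R x) = radial_proj x"
        by (intro radial_proj_scaleR) auto
      then show "?u x = ?u (x + t *\<^sub>R x)"
        by (simp add: scaleR_add_left)
    qed auto
    from vector_derivative_unique_at[OF 1 2] show ?thesis .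
  qed
  finally show ?thesis .
qed

section \<open>Green's identity for zonal functions\<close>

text \<open>
  The cosine of the angle between \<open>\<xi>\<close> and \<open>x\<close>, together with its first and pure second partial
  derivatives. A zonal function with pole \<open>\<xi>\<close>, extended constantly along rays, is a function of this
  cosine.
\<close>

definition colatitude_cos :: "real ^ 3 \<Rightarrow> real ^ 3 \<Rightarrow> real" where
  "colatitude_cos \<xi> x = (\<xi> \<bullet> x) / norm x"

definition colatitude_cos' :: "real ^ 3 \<Rightarrow> 3 \<Rightarrow> real ^ 3 \<Rightarrow> real" where
  "colatitude_cos' \<xi> i x = \<xi> $ i / norm x - (\<xi> \<bullet> x) * x $ i / norm x ^ 3"

definition colatitude_cos'' :: "real ^ 3 \<Rightarrow> 3 \<Rightarrow> real ^ 3 \<Rightarrow> real" where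
  "colatitude_cos'' \<xi> i x =
     - 2 * (\<xi> $ i * x $ i) / norm x ^ 3 - (\<xi> \<bullet> x) / norm x ^ 3 + 3 * (\<xi> \<bullet> x) * (x $ i * x $ i) / norm x ^ 5"

lemma colatitude_cos_has_derivative:
  assumes "x \<noteq> 0"
  shows "((\<lambda>t. colatitude_cos \<xi> (x + t *\<^sub>R axis i 1)) has_real_derivative colatitude_cos' \<xi> i x) (at 0)"
  unfolding colatitude_cos_def colatitude_cos'_def using assms
  by (auto intro!: derivative_eq_intros coordinate_line_has_derivative norm_line_has_derivative
      simp: field_simps eval_nat_numeral)

lemma colatitude_cos'_has_derivative:
  assumes "x \<noteq> 0"
  shows "((\<lambda>t. colatitude_cos' \<xi> i (x + t *\<^sub>R axis i 1)) has_real_derivative colatitude_cos'' \<xi> i x) (at 0)"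
  unfolding colatitude_cos'_def colatitude_cos''_def using assms
  by - ((rule derivative_eq_intros coordinate_line_has_derivative norm_line_has_derivative refl | assumption | simp)+,
      simp add: field_simps eval_nat_numeral)

lemma sum_coordinates_eq_inner:
  fixes x \<xi> :: "real ^ 3"
  shows "(\<Sum>i\<in>UNIV. \<xi> $ i * x $ i) = \<xi> \<bullet> x"
  by (simp add: inner_vec_def)

lemma colatitude_cos'_tangential:
  assumes "x \<noteq> 0"
  shows "(\<Sum>i\<in>UNIV. x $ i * colatitude_cos' \<xi> i x) = 0"
proof -
  have "(\<Sum>i\<in>UNIV. x $ i * colatitude_cos' \<xi> i x) =
      (\<Sum>i\<in>UNIV. \<xi> $ i * x $ i) / norm x - (\<xi> \<bullet> x) * (\<Sum>i\<in>UNIV. x $ i * x $ i) / norm x ^ 3"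
    by (simp add: colatitude_cos'_def sum_subtractf sum_divide_distrib sum_distrib_left algebra_simps)
  also have "\<dots> = 0"
    using assms by (simp add: sum_coordinates_eq_inner dot_square_norm field_simps eval_nat_numeral)
  finally show ?thesis .
qed

lemma colatitude_cos_gradient:
  assumes "x \<noteq> 0" and \<xi>: "\<xi> \<in> S2"
  shows "(x \<bullet> x) * (\<Sum>i\<in>UNIV. (colatitude_cos' \<xi> i x)\<^sup>2) = 1 - (colatitude_cos \<xi> x)\<^sup>2"
proof -
  have "(\<Sum>i\<in>UNIV. (colatitude_cos' \<xi> i x)\<^sup>2) =
      (\<Sum>i\<in>UNIV. \<xi> $ i * \<xi> $ i) / norm x ^ 2 - 2 * (\<xi> \<bullet> x) * (\<Sum>i\<in>UNIV. \<xi> $ i * x $ i) / norm x ^ 4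
       + (\<xi> \<bullet> x)\<^sup>2 * (\<Sum>i\<in>UNIV. x $ i * x $ i) / norm x ^ 6"
    using assms(1) unfolding sum_divide_distrib sum_distrib_left sum_subtractf[symmetric] sum.distrib[symmetric]
    by (intro sum.cong refl) (simp add: colatitude_cos'_def field_simps eval_nat_numeral)
  also have "\<dots> = 1 / norm x ^ 2 - 2 * (\<xi> \<bullet> x) * (\<xi> \<bullet> x) / norm x ^ 4
       + (\<xi> \<bullet> x)\<^sup>2 * (norm x)\<^sup>2 / norm x ^ 6"
    using \<xi> by (simp add: sum_coordinates_eq_inner dot_square_norm)
  finally show ?thesis
    using assms(1) by (simp add: colatitude_cos_def dot_square_norm field_simps eval_nat_numeral)
qed

lemma colatitude_cos_laplacian:
  assumes "x \<noteq> 0"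
  shows "(x \<bullet> x) * (\<Sum>i\<in>UNIV. colatitude_cos'' \<xi> i x) = - 2 * colatitude_cos \<xi> x"
proof -
  have "(\<Sum>i\<in>UNIV. colatitude_cos'' \<xi> i x) = - 2 * (\<Sum>i\<in>UNIV. \<xi> $ i * x $ i) / norm x ^ 3
     - 3 * ((\<xi> \<bullet> x) / norm x ^ 3) + 3 * (\<xi> \<bullet> x) * (\<Sum>i\<in>UNIV. x $ i * x $ i) / norm x ^ 5"
    by (simp add: colatitude_cos''_def sum.distrib sum_subtractf sum_divide_distrib sum_distrib_left sum_negf)
  also have "\<dots> = - 2 * (\<xi> \<bullet> x) / norm x ^ 3 - 3 * ((\<xi> \<bullet> x) / norm x ^ 3) + 3 * (\<xi> \<bullet> x) * (norm x)\<^sup>2 / norm x ^ 5"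
    by (simp add: sum_coordinates_eq_inner dot_square_norm)
  finally show ?thesis
    using assms by (simp add: colatitude_cos_def dot_square_norm field_simps eval_nat_numeral)
qed

lemma colatitude_cos_range:
  assumes "\<xi> \<in> S2"
  shows "colatitude_cos \<xi> x \<in> {-1..1}"
  using Cauchy_Schwarz_ineq2[of \<xi> x] assms
  by (cases "x = 0") (auto simp: colatitude_cos_def divide_simps abs_le_iff)

lemma colatitude_cos_radial_proj: "colatitude_cos \<xi> x = \<xi> \<bullet> radial_proj x"
  by (simp add: colatitude_cos_def radial_proj_def divide_inverse mult.commute)

lemma inner_S2_range: "\<xi> \<in> S2 \<Longrightarrow> \<zeta> \<in> S2 \<Longrightarrow> \<xi> \<bullet> \<zeta> \<in> {-1..1}"
  using colatitude_cos_range[of \<xi> \<zeta>] by (simp add: colatitude_cos_def)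

text \<open>
  Green's second identity on the sphere for an eigenfunction \<open>f\<close> and a zonal function
  \<open>\<zeta> \<mapsto> g (\<xi> \<bullet> \<zeta>)\<close>, whose Laplace-Beltrami image is \<open>((1 - t\<^sup>2) g')'\<close> at \<open>t = \<xi> \<bullet> \<zeta>\<close>. With \<open>u\<close> and \<open>G\<close> the
  extensions of \<open>f\<close> and of the zonal function that are constant along rays, the field
  \<open>\<bar>x\<bar>\<^sup>2 (u \<nabla>G - G \<nabla>u)\<close> is tangential, and its divergence \<open>\<bar>x\<bar>\<^sup>2 (u \<Delta>G - G \<Delta>u)\<close> is homogeneous of
  degree \<open>0\<close>; the factor \<open>\<bar>x\<bar>\<^sup>2\<close> is there for the latter reason.
  
  What matters later is that \<open>g\<close> does not depend on the eigenvalue \<open>\<mu>\<close>.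
\<close>

theorem green_zonal:
  fixes g g' g'' :: "real \<Rightarrow> real"
  assumes C2: "C2_on (- {0}) (f \<circ> radial_proj)"
    and eigen: "\<And>\<zeta>. \<zeta> \<in> S2 \<Longrightarrow> laplace_beltrami f \<zeta> = \<mu> * f \<zeta>"
    and g: "\<And>t. t \<in> {-1..1} \<Longrightarrow> (g has_real_derivative g' t) (at t)"
    and g': "\<And>t. t \<in> {-1..1} \<Longrightarrow> (g' has_real_derivative g'' t) (at t)"
    and cont_g'': "continuous_on {-1..1} g''"
    and \<xi>: "\<xi> \<in> S2"
  shows "(LINT \<zeta>|surface_measure.
      ((1 - (\<xi> \<bullet> \<zeta>)\<^sup>2) * g'' (\<xi> \<bullet> \<zeta>) - 2 * (\<xi> \<bullet> \<zeta>) * g' (\<xi> \<bullet> \<zeta>)) *\<^sub>R f \<zeta>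
        - g (\<xi> \<bullet> \<zeta>) *\<^sub>R (\<mu> * f \<zeta>)) = 0"
proof -
  define u where "u = f \<circ> radial_proj"
  define \<tau> where "\<tau> = colatitude_cos \<xi>"
  define G where "G = (\<lambda>x. g (\<tau> x))"
  define G' where "G' = (\<lambda>i x. g' (\<tau> x) * colatitude_cos' \<xi> i x)"
  define G'' where "G'' = (\<lambda>i x. g'' (\<tau> x) * (colatitude_cos' \<xi> i x)\<^sup>2 + g' (\<tau> x) * colatitude_cos'' \<xi> i x)"
  define V where "V = (\<lambda>i x. G' i x *\<^sub>R u x - G x *\<^sub>R partial_deriv i u x)"
  define V' where "V' = (\<lambda>i x. G'' i x *\<^sub>R u x - G x *\<^sub>R partial_deriv i (partial_deriv i u) x)"
  have \<tau>: "\<tau> x \<in> {-1..1}" for x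
    unfolding \<tau>_def by (rule colatitude_cos_range[OF \<xi>])
  have C2: "u differentiable at x" "partial_deriv i u differentiable at x" if "x \<noteq> 0" for x i
    using C2 that by (auto simp: C2_on_def u_def)
  have cont_u2: "continuous_on (- {0}) (partial_deriv i (partial_deriv j u))" for i j
    using assms(1) by (auto simp: C2_on_def u_def)
  have cont_u: "continuous_on (- {0}) u" "continuous_on (- {0}) (partial_deriv i u)" for i
    using C2 by (auto intro!: continuous_at_imp_continuous_on differentiable_imp_continuous_within)
  have cont_\<tau>: "continuous_on (- {0}) \<tau>" "continuous_on (- {0}) (colatitude_cos' \<xi> i)"
    "continuous_on (- {0}) (colatitude_cos'' \<xi> i)" for i
    unfolding \<tau>_def colatitude_cos_def[abs_def] colatitude_cos'_def[abs_def] colatitude_cos''_def[abs_def]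
    by (intro continuous_intros; simp)+
  have cont_gs: "continuous_on {-1..1} g" "continuous_on {-1..1} g'"
    by (rule DERIV_continuous_on[OF has_field_derivative_at_within[OF g]], assumption,
        rule DERIV_continuous_on[OF has_field_derivative_at_within[OF g']], assumption)
  have cont_g\<tau>: "continuous_on (- {0}) (\<lambda>x. k (\<tau> x))" if "continuous_on {-1..1} k" for k :: "real \<Rightarrow> real"
    by (rule continuous_on_compose2[OF that cont_\<tau>(1)]) (use \<tau> in auto)
  note conts = cont_u cont_u2 cont_\<tau> cont_g\<tau>[OF cont_gs(1)] cont_g\<tau>[OF cont_gs(2)] cont_g\<tau>[OF cont_g'']
  have der_G: "((\<lambda>t. G (x + t *\<^sub>R axis i 1)) has_real_derivative G' i x) (at 0)"
    and der_G': "((\<lambda>t. G' i (x + t *\<^sub>R axis i 1)) has_real_derivative G'' i x) (at 0)" if x: "x \<noteq> 0" for x i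
  proof -
    have D\<tau>: "((\<lambda>t. \<tau> (x + t *\<^sub>R axis i 1)) has_real_derivative colatitude_cos' \<xi> i x) (at 0)"
      unfolding \<tau>_def by (rule colatitude_cos_has_derivative[OF x])
    have Dg: "(g has_real_derivative g' (\<tau> x)) (at (\<tau> (x + 0 *\<^sub>R axis i 1)))"
      "(g' has_real_derivative g'' (\<tau> x)) (at (\<tau> (x + 0 *\<^sub>R axis i 1)))"
      using g[OF \<tau>[of x]] g'[OF \<tau>[of x]] by simp_all
    show "((\<lambda>t. G (x + t *\<^sub>R axis i 1)) has_real_derivative G' i x) (at 0)"
      unfolding G_def G'_def
      by (rule DERIV_chain2[where f = g and g = "\<lambda>t. \<tau> (x + t *\<^sub>R axis i 1)", OF Dg(1) D\<tau>])
    have 1: "((\<lambda>t. g' (\<tau> (x + t *\<^sub>R axis i 1))) has_real_derivative g'' (\<tau> x) * colatitude_cos' \<xi> i x) (at 0)"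
      by (rule DERIV_chain2[where f = g' and g = "\<lambda>t. \<tau> (x + t *\<^sub>R axis i 1)", OF Dg(2) D\<tau>])
    show "((\<lambda>t. G' i (x + t *\<^sub>R axis i 1)) has_real_derivative G'' i x) (at 0)"
      unfolding G'_def G''_def
      by (rule DERIV_cong[OF DERIV_mult[OF 1 colatitude_cos'_has_derivative[OF x]]])
         (simp add: power2_eq_square)
  qed
  have "(LINT \<zeta>|surface_measure. ((1 - (\<xi> \<bullet> \<zeta>)\<^sup>2) * g'' (\<xi> \<bullet> \<zeta>) - 2 * (\<xi> \<bullet> \<zeta>) * g' (\<xi> \<bullet> \<zeta>)) *\<^sub>R f \<zeta>
        - g (\<xi> \<bullet> \<zeta>) *\<^sub>R (\<mu> * f \<zeta>)) = 0"
  proof (rule integral_tangential_divergence_eq_0[where W = "\<lambda>i x. (x \<bullet> x) *\<^sub>R V i x"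
        and D = "\<lambda>i x. (x \<bullet> x) *\<^sub>R V' i x + (2 * x $ i) *\<^sub>R V i x"])
    show "((\<lambda>t. ((x + t *\<^sub>R axis i 1) \<bullet> (x + t *\<^sub>R axis i 1)) *\<^sub>R V i (x + t *\<^sub>R axis i 1)) has_vector_derivative
        (x \<bullet> x) *\<^sub>R V' i x + (2 * x $ i) *\<^sub>R V i x) (at 0)" if x: "x \<noteq> 0" for i x
    proof -
      have Du: "((\<lambda>t. u (x + t *\<^sub>R axis i 1)) has_vector_derivative partial_deriv i u x) (at 0)"
        and Du': "((\<lambda>t. partial_deriv i u (x + t *\<^sub>R axis i 1)) has_vector_derivative
           partial_deriv i (partial_deriv i u) x) (at 0)"
        using C2[OF x] by (auto intro: has_vector_derivative_partial_deriv)
      have DV: "((\<lambda>t. V i (x + t *\<^sub>R axis i 1)) has_vector_derivative V' i x) (at 0)"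
        using has_vector_derivative_diff[OF has_vector_derivative_scaleR[OF der_G'[OF x, of i] Du]
            has_vector_derivative_scaleR[OF der_G[OF x, of i] Du']]
        by (simp add: V_def V'_def)
      show ?thesis
        using has_vector_derivative_scaleR[OF coordinate_line_has_derivative(3) DV] by simp
    qed
    have cont_V: "continuous_on (- {0}) (V i)" "continuous_on (- {0}) (V' i)" for i
      unfolding V_def V'_def G_def G'_def G''_def by (intro continuous_intros conts)+
    then show "continuous_on (- {0}) (\<lambda>x. (x \<bullet> x) *\<^sub>R V i x)"
      "continuous_on (- {0}) (\<lambda>x. (x \<bullet> x) *\<^sub>R V' i x + (2 * x $ i) *\<^sub>R V i x)" for i
      by (intro continuous_intros; simp)+
    have tang: "(\<Sum>i\<in>UNIV. x $ i *\<^sub>R V i x) = 0" if x: "x \<noteq> 0" for x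
    proof -
      have "(\<Sum>i\<in>UNIV. x $ i *\<^sub>R V i x) =
        (g' (\<tau> x) * (\<Sum>i\<in>UNIV. x $ i * colatitude_cos' \<xi> i x)) *\<^sub>R u x
        - G x *\<^sub>R (\<Sum>i\<in>UNIV. x $ i *\<^sub>R partial_deriv i u x)"
        by (simp add: V_def G'_def scaleR_diff_right sum_subtractf scaleR_sum_right scaleR_sum_left
            sum_distrib_left ac_simps)
      also have "\<dots> = 0"
        using colatitude_cos'_tangential[OF x] radial_extension_euler[of f x] C2(1)[OF x] x
        by (simp add: u_def)
      finally show ?thesis .
    qed
    show "(\<Sum>i\<in>UNIV. x $ i *\<^sub>R (x \<bullet> x) *\<^sub>R V i x) = 0" if "x \<noteq> 0" for x
    proof -
      have "(\<Sum>i\<in>UNIV. x $ i *\<^sub>R (x \<bullet> x) *\<^sub>R V i x) = (x \<bullet> x) *\<^sub>R (\<Sum>i\<in>UNIV. x $ i *\<^sub>R V i x)"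
        unfolding scaleR_sum_right by (intro sum.cong refl) (rule scaleR_left_commute)
      then show ?thesis by (simp only: tang[OF that] scaleR_zero_right)
    qed
    show "(\<Sum>i\<in>UNIV. (x \<bullet> x) *\<^sub>R V' i x + (2 * x $ i) *\<^sub>R V i x) =
        ((1 - (\<xi> \<bullet> radial_proj x)\<^sup>2) * g'' (\<xi> \<bullet> radial_proj x)
            - 2 * (\<xi> \<bullet> radial_proj x) * g' (\<xi> \<bullet> radial_proj x)) *\<^sub>R f (radial_proj x)
        - g (\<xi> \<bullet> radial_proj x) *\<^sub>R (\<mu> * f (radial_proj x))" if x: "x \<noteq> 0" for x
    proof -
      have lapG: "(x \<bullet> x) * (\<Sum>i\<in>UNIV. G'' i x) = (1 - (\<tau> x)\<^sup>2) * g'' (\<tau> x) - 2 * \<tau> x * g' (\<tau> x)"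
      proof -
        have "(x \<bullet> x) * (\<Sum>i\<in>UNIV. G'' i x) = g'' (\<tau> x) * ((x \<bullet> x) * (\<Sum>i\<in>UNIV. (colatitude_cos' \<xi> i x)\<^sup>2))
            + g' (\<tau> x) * ((x \<bullet> x) * (\<Sum>i\<in>UNIV. colatitude_cos'' \<xi> i x))"
          by (simp add: G''_def sum.distrib sum_distrib_left algebra_simps)
        then show ?thesis
          by (simp add: colatitude_cos_gradient[OF x \<xi>] colatitude_cos_laplacian[OF x] \<tau>_def algebra_simps)
      qed
      have lapu: "(x \<bullet> x) *\<^sub>R (\<Sum>i\<in>UNIV. partial_deriv i (partial_deriv i u) x) = \<mu> * f (radial_proj x)"
        using laplacian_radial_extension[OF assms(1) x] eigen[OF radial_proj_in_S2[OF x]]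
        by (simp add: laplacian_def u_def)
      have "(\<Sum>i\<in>UNIV. (x \<bullet> x) *\<^sub>R V' i x + (2 * x $ i) *\<^sub>R V i x) =
         ((x \<bullet> x) * (\<Sum>i\<in>UNIV. G'' i x)) *\<^sub>R u x
         - G x *\<^sub>R ((x \<bullet> x) *\<^sub>R (\<Sum>i\<in>UNIV. partial_deriv i (partial_deriv i u) x))
         + 2 *\<^sub>R (\<Sum>i\<in>UNIV. x $ i *\<^sub>R V i x)"
        by (simp add: V'_def scaleR_diff_right sum_subtractf sum.distrib scaleR_sum_right scaleR_sum_left
            sum_distrib_left ac_simps)
      then show ?thesis
        by (simp add: lapG lapu tang[OF x] G_def) (simp add: \<tau>_def colatitude_cos_radial_proj u_def)
    qed
    have cont_f: "continuous_on S2 f"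
    proof (rule continuous_on_eq)
      show "continuous_on S2 u"
        by (rule continuous_on_subset[OF cont_u(1)]) auto
    qed (auto simp: u_def radial_proj_S2)
    have cont_in: "continuous_on S2 (\<lambda>\<zeta>. k (\<xi> \<bullet> \<zeta>))" if "continuous_on {-1..1} k" for k :: "real \<Rightarrow> real"
      by (rule continuous_on_compose2[OF that]) (use inner_S2_range[OF \<xi>] in \<open>auto intro!: continuous_intros\<close>)
    show "continuous_on S2 (\<lambda>\<zeta>. ((1 - (\<xi> \<bullet> \<zeta>)\<^sup>2) * g'' (\<xi> \<bullet> \<zeta>) - 2 * (\<xi> \<bullet> \<zeta>) * g' (\<xi> \<bullet> \<zeta>)) *\<^sub>R f \<zeta>
        - g (\<xi> \<bullet> \<zeta>) *\<^sub>R (\<mu> * f \<zeta>))"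
      by (intro continuous_intros cont_f cont_in[OF cont_gs(1)] cont_in[OF cont_gs(2)] cont_in[OF cont_g''])
  qed
  then show ?thesis .
qed

section \<open>Integration of continuous and of zonal functions\<close>

lemma finite_surface_measure: "finite_measure surface_measure"
  by (rule finite_measureI) (simp add: space_surface_measure emeasure_surface_measure_S2)

interpretation surface: finite_measure surface_measure
  by (rule finite_surface_measure)

lemma measure_surface_measure_S2: "measure surface_measure S2 = 4 * pi"
  by (simp add: measure_def emeasure_surface_measure_S2)

lemma continuous_on_S2_bounded:
  fixes \<Phi> :: "real ^ 3 \<Rightarrow> 'b::real_normed_vector"
  assumes "continuous_on S2 \<Phi>"
  obtains B where "0 \<le> B" and "\<And>\<zeta>. \<zeta> \<in> S2 \<Longrightarrow> norm (\<Phi> \<zeta>) \<le> B"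
proof -
  have "bounded (\<Phi> ` S2)"
    by (intro compact_imp_bounded compact_continuous_image assms) auto
  then obtain B where B: "\<forall>y \<in> \<Phi> ` S2. norm y \<le> B"
    unfolding bounded_iff by blast
  show thesis
  proof
    show "0 \<le> max 0 B" by simp
    show "norm (\<Phi> \<zeta>) \<le> max 0 B" if "\<zeta> \<in> S2" for \<zeta>
      using B that by (intro max.coboundedI2) blast
  qed
qed

lemma integrable_continuous_surface_measure:
  fixes \<Phi> :: "real ^ 3 \<Rightarrow> 'b::{banach, second_countable_topology}"
  assumes "continuous_on S2 \<Phi>"
  shows "integrable surface_measure \<Phi>"
proof -
  obtain B where "0 \<le> B" and B: "\<And>\<zeta>. \<zeta> \<in> S2 \<Longrightarrow> norm (\<Phi> \<zeta>) \<le> B"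
    using continuous_on_S2_bounded[OF assms] by blast
  show ?thesis
    by (rule surface.integrable_const_bound[where B = B])
       (use B assms in \<open>auto simp: space_surface_measure intro: borel_measurable_surface_measure_continuous\<close>)
qed

lemma integrable_scaleR_continuous_surface_measure:
  fixes k :: "real ^ 3 \<Rightarrow> real" and \<Phi> :: "real ^ 3 \<Rightarrow> 'b::{banach, second_countable_topology}"
  assumes k: "integrable surface_measure k" and \<Phi>: "continuous_on S2 \<Phi>"
  shows "integrable surface_measure (\<lambda>\<zeta>. k \<zeta> *\<^sub>R \<Phi> \<zeta>)"
proof -
  obtain B where "0 \<le> B" and B: "\<And>\<zeta>. \<zeta> \<in> S2 \<Longrightarrow> norm (\<Phi> \<zeta>) \<le> B"
    using continuous_on_S2_bounded[OF \<Phi>] by blast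
  have [measurable]: "\<Phi> \<in> borel_measurable surface_measure" "k \<in> borel_measurable surface_measure"
    using k \<Phi> by (auto intro: borel_measurable_surface_measure_continuous)
  show ?thesis
  proof (rule Bochner_Integration.integrable_bound)
    show "integrable surface_measure (\<lambda>\<zeta>. k \<zeta> * B)"
      using k by simp
    show "AE \<zeta> in surface_measure. norm (k \<zeta> *\<^sub>R \<Phi> \<zeta>) \<le> norm (k \<zeta> * B)"
      using B \<open>0 \<le> B\<close> by (intro AE_I2) (auto simp: space_surface_measure abs_mult intro!: mult_left_mono)
  qed measurable
qed

lemma continuous_on_zonal:
  fixes k :: "real \<Rightarrow> real"
  assumes "continuous_on {-1..1} k" and "\<xi> \<in> S2"
  shows "continuous_on S2 (\<lambda>\<zeta>. k (\<xi> \<bullet> \<zeta>))"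
proof (rule continuous_on_compose2[OF assms(1)])
  show "continuous_on S2 (\<lambda>\<zeta>. \<xi> \<bullet> \<zeta>)"
    by (intro continuous_intros)
  show "(\<lambda>\<zeta>. \<xi> \<bullet> \<zeta>) ` S2 \<subseteq> {-1..1}"
    using inner_S2_range[OF assms(2)] by blast
qed

lemma constant_harmonic:
  fixes c :: complex
  shows "C2_on (- {0}) ((\<lambda>_. c) \<circ> radial_proj)" and "laplace_beltrami (\<lambda>_. c) \<zeta> = 0"
proof -
  have 1: "partial_deriv i (\<lambda>_. d) = (\<lambda>_. 0)" for i and d :: complex
    by (simp add: partial_deriv_def fun_eq_iff)
  show "C2_on (- {0}) ((\<lambda>_. c) \<circ> radial_proj)"
    by (simp add: C2_on_def o_def 1)
  show "laplace_beltrami (\<lambda>_. c) \<zeta> = 0"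
    by (simp add: laplace_beltrami_def laplacian_def o_def 1)
qed

text \<open>
  Green's identity against the constant eigenfunction \<open>1\<close>. Explicit choices of \<open>g\<close> turn this into
  values and bounds of integrals of zonal functions, without coordinates on the sphere.
\<close>

lemma integral_zonal_laplacian_eq_0:
  fixes g g' g'' :: "real \<Rightarrow> real"
  assumes g: "\<And>t. t \<in> {-1..1} \<Longrightarrow> (g has_real_derivative g' t) (at t)"
    and g': "\<And>t. t \<in> {-1..1} \<Longrightarrow> (g' has_real_derivative g'' t) (at t)"
    and cont_g'': "continuous_on {-1..1} g''"
    and \<xi>: "\<xi> \<in> S2"
  shows "(LINT \<zeta>|surface_measure. (1 - (\<xi> \<bullet> \<zeta>)\<^sup>2) * g'' (\<xi> \<bullet> \<zeta>) - 2 * (\<xi> \<bullet> \<zeta>) * g' (\<xi> \<bullet> \<zeta>)) = 0"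
proof -
  have "(LINT \<zeta>|surface_measure.
      ((1 - (\<xi> \<bullet> \<zeta>)\<^sup>2) * g'' (\<xi> \<bullet> \<zeta>) - 2 * (\<xi> \<bullet> \<zeta>) * g' (\<xi> \<bullet> \<zeta>)) *\<^sub>R (1::complex)
        - g (\<xi> \<bullet> \<zeta>) *\<^sub>R (0 * 1)) = 0"
    by (rule green_zonal[where f = "\<lambda>_. 1"]) (use assms constant_harmonic in auto)
  then have "(LINT \<zeta>|surface_measure. complex_of_real
      ((1 - (\<xi> \<bullet> \<zeta>)\<^sup>2) * g'' (\<xi> \<bullet> \<zeta>) - 2 * (\<xi> \<bullet> \<zeta>) * g' (\<xi> \<bullet> \<zeta>))) = 0"
    by (simp add: scaleR_conv_of_real)
  then show ?thesis
    unfolding integral_complex_of_real by (simp only: of_real_eq_0_iff)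
qed

section \<open>Regularized logarithmic potentials\<close>

text \<open>
  For \<open>a > 1\<close> the Laplace-Beltrami operator maps the zonal function with profile \<open>ln (a - t)\<close> to
  \<open>poisson a t - 1\<close>. As \<open>a\<close> decreases to \<open>1\<close>, the kernel \<open>poisson a\<close> concentrates at the pole with
  constant total mass, and the limit \<open>ln (1 - t)\<close> is, up to normalization, Green's function of the
  sphere.
\<close>

definition poisson :: "real \<Rightarrow> real \<Rightarrow> real" where
  "poisson a t = (a\<^sup>2 - 1) / (a - t)\<^sup>2"

lemma log_potential_derivatives:
  fixes a t :: real
  assumes "a > 1" and "t \<in> {-1..1}"
  shows "((\<lambda>t. ln (a - t)) has_real_derivative - (1 / (a - t))) (at t)"
    and "((\<lambda>t. - (1 / (a - t))) has_real_derivative - (1 / (a - t)\<^sup>2)) (at t)"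
    and "(1 - t\<^sup>2) * - (1 / (a - t)\<^sup>2) - 2 * t * - (1 / (a - t)) = poisson a t - 1"
proof -
  have "a - t > 0" using assms by auto
  then show "((\<lambda>t. ln (a - t)) has_real_derivative - (1 / (a - t))) (at t)"
    and "((\<lambda>t. - (1 / (a - t))) has_real_derivative - (1 / (a - t)\<^sup>2)) (at t)"
    by (auto intro!: derivative_eq_intros simp: power2_eq_square)
  show "(1 - t\<^sup>2) * - (1 / (a - t)\<^sup>2) - 2 * t * - (1 / (a - t)) = poisson a t - 1"
    using \<open>a - t > 0\<close> by (simp add: poisson_def divide_simps) (simp add: power2_eq_square algebra_simps)
qed

lemma continuous_on_kernels:
  fixes a :: real
  assumes "a > 1"
  shows "continuous_on {-1..1} (poisson a)" and "continuous_on {-1..1} (\<lambda>t. ln (a - t))"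
    and "continuous_on {-1..1} (\<lambda>t. - (1 / (a - t)\<^sup>2))" and "continuous_on {-1..1} (\<lambda>t. 1 / sqrt (a - t))"
  unfolding poisson_def[abs_def] using assms
  by (auto intro!: continuous_intros)

lemma integral_poisson:
  assumes a: "a > 1" and \<xi>: "\<xi> \<in> S2"
  shows "(LINT \<zeta>|surface_measure. poisson a (\<xi> \<bullet> \<zeta>)) = 4 * pi"
proof -
  have int: "integrable surface_measure (\<lambda>\<zeta>. poisson a (\<xi> \<bullet> \<zeta>))"
    by (intro integrable_continuous_surface_measure continuous_on_zonal continuous_on_kernels a \<xi>)
  have "0 = (LINT \<zeta>|surface_measure. (1 - (\<xi> \<bullet> \<zeta>)\<^sup>2) * - (1 / (a - \<xi> \<bullet> \<zeta>)\<^sup>2) - 2 * (\<xi> \<bullet> \<zeta>) * - (1 / (a - \<xi> \<bullet> \<zeta>)))"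
    by (rule integral_zonal_laplacian_eq_0[symmetric, where g = "\<lambda>t. ln (a - t)"])
       (use log_potential_derivatives(1,2)[OF a] continuous_on_kernels[OF a] \<xi> in auto)
  also have "\<dots> = (LINT \<zeta>|surface_measure. poisson a (\<xi> \<bullet> \<zeta>) - 1)"
    by (intro Bochner_Integration.integral_cong refl log_potential_derivatives(3) a)
       (simp only: space_surface_measure inner_S2_range[OF \<xi>])
  also have "\<dots> = (LINT \<zeta>|surface_measure. poisson a (\<xi> \<bullet> \<zeta>)) - 4 * pi"
    using int by (simp add: space_surface_measure measure_surface_measure_S2)
  finally show ?thesis by simp
qed

lemma integral_poisson_eigenfunction:
  assumes C2: "C2_on (- {0}) (f \<circ> radial_proj)"
    and cont: "continuous_on S2 f"
    and eigen: "\<And>\<zeta>. \<zeta> \<in> S2 \<Longrightarrow> laplace_beltrami f \<zeta> = \<mu> * f \<zeta>"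
    and a: "a > 1" and \<xi>: "\<xi> \<in> S2"
  shows "(LINT \<zeta>|surface_measure. poisson a (\<xi> \<bullet> \<zeta>) *\<^sub>R f \<zeta>) - (LINT \<zeta>|surface_measure. f \<zeta>) =
    \<mu> * (LINT \<zeta>|surface_measure. ln (a - \<xi> \<bullet> \<zeta>) *\<^sub>R f \<zeta>)"
proof -
  have int: "integrable surface_measure (\<lambda>\<zeta>. poisson a (\<xi> \<bullet> \<zeta>) *\<^sub>R f \<zeta>)"
    "integrable surface_measure (\<lambda>\<zeta>. ln (a - \<xi> \<bullet> \<zeta>) *\<^sub>R f \<zeta>)"
    "integrable surface_measure f"
    by (intro integrable_scaleR_continuous_surface_measure integrable_continuous_surface_measure
        continuous_on_zonal continuous_on_kernels a \<xi> cont)+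
  have "0 = (LINT \<zeta>|surface_measure.
      ((1 - (\<xi> \<bullet> \<zeta>)\<^sup>2) * - (1 / (a - \<xi> \<bullet> \<zeta>)\<^sup>2) - 2 * (\<xi> \<bullet> \<zeta>) * - (1 / (a - \<xi> \<bullet> \<zeta>))) *\<^sub>R f \<zeta>
        - ln (a - \<xi> \<bullet> \<zeta>) *\<^sub>R (\<mu> * f \<zeta>))"
    by (rule green_zonal[symmetric, OF C2 eigen, where g = "\<lambda>t. ln (a - t)"])
       (use log_potential_derivatives(1,2)[OF a] continuous_on_kernels[OF a] \<xi> in auto)
  also have "\<dots> = (LINT \<zeta>|surface_measure.
      poisson a (\<xi> \<bullet> \<zeta>) *\<^sub>R f \<zeta> - f \<zeta> - \<mu> * (ln (a - \<xi> \<bullet> \<zeta>) *\<^sub>R f \<zeta>))"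
  proof (rule Bochner_Integration.integral_cong[OF refl])
    fix \<zeta> assume "\<zeta> \<in> space surface_measure"
    then have "\<xi> \<bullet> \<zeta> \<in> {-1..1}"
      using inner_S2_range[OF \<xi>] by (simp only: space_surface_measure)
    from log_potential_derivatives(3)[OF a this]
    show "((1 - (\<xi> \<bullet> \<zeta>)\<^sup>2) * - (1 / (a - \<xi> \<bullet> \<zeta>)\<^sup>2) - 2 * (\<xi> \<bullet> \<zeta>) * - (1 / (a - \<xi> \<bullet> \<zeta>))) *\<^sub>R f \<zeta>
        - ln (a - \<xi> \<bullet> \<zeta>) *\<^sub>R (\<mu> * f \<zeta>)
      = poisson a (\<xi> \<bullet> \<zeta>) *\<^sub>R f \<zeta> - f \<zeta> - \<mu> * (ln (a - \<xi> \<bullet> \<zeta>) *\<^sub>R f \<zeta>)"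
      by (simp only: scaleR_diff_left scaleR_one mult_scaleR_right)
  qed
  also have "\<dots> = (LINT \<zeta>|surface_measure. poisson a (\<xi> \<bullet> \<zeta>) *\<^sub>R f \<zeta>) - (LINT \<zeta>|surface_measure. f \<zeta>)
      - \<mu> * (LINT \<zeta>|surface_measure. ln (a - \<xi> \<bullet> \<zeta>) *\<^sub>R f \<zeta>)"
    by (simp only: Bochner_Integration.integral_diff[OF Bochner_Integration.integrable_diff[OF int(1,3)]
        integrable_mult_right[OF int(2)]] Bochner_Integration.integral_diff[OF int(1,3)] integral_mult_right_zero)
  finally show ?thesis by simp
qed

text \<open>
  Green's identity for the constant profile \<open>1\<close>: an eigenfunction whose eigenvalue is not zero has
  mean zero.
\<close>

lemma integral_eigenfunction:
  assumes C2: "C2_on (- {0}) (f \<circ> radial_proj)"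
    and eigen: "\<And>\<zeta>. \<zeta> \<in> S2 \<Longrightarrow> laplace_beltrami f \<zeta> = \<mu> * f \<zeta>"
  shows "\<mu> * (LINT \<zeta>|surface_measure. f \<zeta>) = 0"
proof -
  have \<xi>: "axis 1 1 \<in> S2" by simp
  have "(LINT \<zeta>|surface_measure.
      ((1 - (axis 1 1 \<bullet> \<zeta>)\<^sup>2) * 0 - 2 * (axis 1 1 \<bullet> \<zeta>) * 0) *\<^sub>R f \<zeta> - 1 *\<^sub>R (\<mu> * f \<zeta>)) = 0"
    by (rule green_zonal[OF C2 eigen, where g = "\<lambda>_. 1" and g' = "\<lambda>_. 0" and g'' = "\<lambda>_. 0", OF _ _ _ _ \<xi>]) auto
  then show ?thesis by simp
qed

section \<open>Integrability of the logarithmic singularity\<close>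

text \<open>
  The bound is uniform in \<open>a\<close>, which gives in the limit that the singularity of \<open>1 / \<surd>(1 - t)\<close> is integrable.
  For \<open>s = a - t\<close> the profile \<open>\<surd>s\<close> has the Laplace-Beltrami image
  \<open>D t = t / \<surd>s - (1 - t\<^sup>2) / (4 s \<surd>s)\<close>. As \<open>1 - t\<^sup>2 \<le> 2 s\<close>, it is at least \<open>(t - 1 / 2) / \<surd>s\<close>: near the pole
  this dominates \<open>1 / (4 \<surd>s)\<close>, and away from it everything is bounded. But \<open>D\<close> integrates to zero.
\<close>

lemma integral_inverse_sqrt_bound:
  assumes a: "a > 1" "a \<le> 2" and \<xi>: "\<xi> \<in> S2"
  shows "(LINT \<zeta>|surface_measure. 1 / sqrt (a - \<xi> \<bullet> \<zeta>)) \<le> 56 * pi"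
proof -
  define g' where "g' = (\<lambda>t. - (1 / (2 * sqrt (a - t))))"
  define g'' where "g'' = (\<lambda>t. - (1 / (4 * (sqrt (a - t) * (a - t)))))"
  define D where "D = (\<lambda>t. (1 - t\<^sup>2) * g'' t - 2 * t * g' t)"
  have g: "((\<lambda>t. sqrt (a - t)) has_real_derivative g' t) (at t)" "(g' has_real_derivative g'' t) (at t)"
    if "t \<in> {-1..1}" for t
  proof -
    have t: "a - t > 0" using that a by auto
    then show "((\<lambda>t. sqrt (a - t)) has_real_derivative g' t) (at t)"
      unfolding g'_def by (auto intro!: derivative_eq_intros simp: divide_simps)
    show "(g' has_real_derivative g'' t) (at t)"
      unfolding g'_def g''_def using t by (auto intro!: derivative_eq_intros simp: divide_simps)
  qed
  have cont: "continuous_on {-1..1} g'" "continuous_on {-1..1} g''"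
    unfolding g'_def g''_def using a by (auto intro!: continuous_intros)
  have int_D: "integrable surface_measure (\<lambda>\<zeta>. D (\<xi> \<bullet> \<zeta>))"
    unfolding D_def by (intro integrable_continuous_surface_measure continuous_on_zonal \<xi> continuous_intros cont)
  have bound: "1 / sqrt (a - t) \<le> 4 * D t + 14" if "t \<in> {-1..1}" for t
  proof -
    define r where "r = sqrt (a - t)"
    have s: "a - t > 0" "t \<le> 1" "-1 \<le> t" using that a by auto
    then have r: "r > 0" "a - t = r\<^sup>2" by (auto simp: r_def)
    have "1 - t\<^sup>2 = (1 - t) * (1 + t)" by (simp add: power2_eq_square algebra_simps)
    also have "\<dots> \<le> r\<^sup>2 * 2"
      using s a r by (intro mult_mono) auto
    finally have "(1 - t\<^sup>2) / (4 * (r * r\<^sup>2)) \<le> (r\<^sup>2 * 2) / (4 * (r * r\<^sup>2))"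
      using r by (intro divide_right_mono) auto
    also have "\<dots> = 1 / (2 * r)" using r by (simp add: field_simps)
    finally have "D t \<ge> t / r - 1 / (2 * r)"
      using r(1) by (simp add: D_def g'_def g''_def r_def[symmetric] r(2))
    moreover have "t / r - 1 / (2 * r) = (t - 1 / 2) * (1 / r)"
      using r by (simp add: field_simps)
    ultimately have D: "D t \<ge> (t - 1 / 2) * (1 / r)" by simp
    show ?thesis
    proof (cases "t \<ge> 3 / 4")
      case True
      then have "(1 / 4) * (1 / r) \<le> (t - 1 / 2) * (1 / r)"
        using r by (intro mult_right_mono) auto
      with D show ?thesis by (simp add: r_def)
    next
      case False
      then have "(1 / 2)\<^sup>2 \<le> r\<^sup>2" using r a by (simp add: power2_eq_square)
      then have "1 / 2 \<le> r" by (rule power2_le_imp_le) (use r in simp)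
      then have *: "1 / r \<le> 2" "0 \<le> 1 / r" using r by (auto simp: field_simps)
      have "(1 / 2 - t) * (1 / r) \<le> (3 / 2) * (1 / r)"
        using s * by (intro mult_right_mono) auto
      moreover have "(t - 1 / 2) * (1 / r) = - ((1 / 2 - t) * (1 / r))"
        by (simp add: algebra_simps)
      ultimately have "D t \<ge> - 3" using D * by linarith
      with * show ?thesis by (simp add: r_def)
    qed
  qed
  have "(LINT \<zeta>|surface_measure. 1 / sqrt (a - \<xi> \<bullet> \<zeta>)) \<le> (LINT \<zeta>|surface_measure. 4 * D (\<xi> \<bullet> \<zeta>) + 14)"
  proof (rule integral_mono)
    show "integrable surface_measure (\<lambda>\<zeta>. 1 / sqrt (a - \<xi> \<bullet> \<zeta>))"
      by (intro integrable_continuous_surface_measure continuous_on_zonal continuous_on_kernels a \<xi>)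
    show "integrable surface_measure (\<lambda>\<zeta>. 4 * D (\<xi> \<bullet> \<zeta>) + 14)"
      using int_D by simp
  qed (use bound inner_S2_range[OF \<xi>] in \<open>simp add: space_surface_measure\<close>)
  also have "\<dots> = 4 * (LINT \<zeta>|surface_measure. D (\<xi> \<bullet> \<zeta>)) + 14 * (4 * pi)"
    using int_D by (simp add: space_surface_measure measure_surface_measure_S2)
  also have "(LINT \<zeta>|surface_measure. D (\<xi> \<bullet> \<zeta>)) = 0"
    unfolding D_def by (rule integral_zonal_laplacian_eq_0[OF g cont(2) \<xi>])
  finally show ?thesis by simp
qed

text \<open>
  The mass of a point \<open>\<xi>\<close> is bounded by a multiple of \<open>\<surd>(a - 1)\<close> for every \<open>a > 1\<close> close to \<open>1\<close>, since
  \<open>1 / \<surd>(a - \<xi> \<bullet> \<zeta>)\<close> takes the value \<open>1 / \<surd>(a - 1)\<close> there and its integral stays bounded.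
\<close>

lemma AE_surface_measure_neq:
  assumes \<xi>: "\<xi> \<in> S2"
  shows "AE \<zeta> in surface_measure. \<zeta> \<noteq> \<xi>"
proof -
  have sets: "{\<xi>} \<in> sets surface_measure"
    using \<xi> unfolding sets_surface_measure by (auto simp: sets_restrict_space)
  have bound: "measure surface_measure {\<xi>} \<le> 56 * pi * sqrt (a - 1)" if a: "a > 1" "a \<le> 2" for a
  proof -
    have \<xi>\<xi>: "\<xi> \<bullet> \<xi> = 1" using \<xi> by (simp add: dot_square_norm)
    have "(LINT \<zeta>|surface_measure. indicator {\<xi>} \<zeta> * (1 / sqrt (a - 1))) \<le> (LINT \<zeta>|surface_measure. 1 / sqrt (a - \<xi> \<bullet> \<zeta>))"
    proof (rule integral_mono)
      show "integrable surface_measure (\<lambda>\<zeta>. indicator {\<xi>} \<zeta> * (1 / sqrt (a - 1)))"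
        by (intro integrable_mult_left integrable_real_indicator sets) (simp add: surface.emeasure_eq_measure)
      show "integrable surface_measure (\<lambda>\<zeta>. 1 / sqrt (a - \<xi> \<bullet> \<zeta>))"
        by (intro integrable_continuous_surface_measure continuous_on_zonal continuous_on_kernels a \<xi>)
      show "indicator {\<xi>} \<zeta> * (1 / sqrt (a - 1)) \<le> 1 / sqrt (a - \<xi> \<bullet> \<zeta>)" if "\<zeta> \<in> space surface_measure" for \<zeta>
      proof -
        have "\<xi> \<bullet> \<zeta> \<in> {-1..1}"
          using inner_S2_range[OF \<xi>] that by (simp only: space_surface_measure)
        then show ?thesis using a by (auto simp: indicator_def \<xi>\<xi>)
      qed
    qed
    also have "\<dots> \<le> 56 * pi"
      by (rule integral_inverse_sqrt_bound[OF a \<xi>])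
    finally have "measure surface_measure {\<xi>} * (1 / sqrt (a - 1)) \<le> 56 * pi"
      using sets by simp
    then show ?thesis using a by (simp add: field_simps)
  qed
  have "((\<lambda>a. 56 * pi * sqrt (a - 1)) \<longlongrightarrow> 56 * pi * sqrt (1 - 1)) (at_right 1)"
    by (intro tendsto_intros)
  moreover have "\<forall>\<^sub>F a in at_right (1::real). measure surface_measure {\<xi>} \<le> 56 * pi * sqrt (a - 1)"
  proof -
    have "\<forall>\<^sub>F a in at_right (1::real). a \<in> {1<..<2}"
      by (rule eventually_at_right_real) simp
    then show ?thesis
      by eventually_elim (rule bound; simp)
  qed
  ultimately have "measure surface_measure {\<xi>} \<le> 56 * pi * sqrt (1 - 1)"
    by (rule tendsto_lowerbound) simp
  then have "emeasure surface_measure {\<xi>} = 0"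
    using measure_nonneg[of surface_measure "{\<xi>}"] by (simp add: surface.emeasure_eq_measure)
  then show ?thesis
    using sets by (intro AE_I[where N = "{\<xi>}"]) auto
qed

definition approach_one :: "nat \<Rightarrow> real" where
  "approach_one n = 1 + inverse (real (Suc n))"

lemma approach_one: "approach_one n > 1" "approach_one n \<le> 2" "approach_one \<longlonglongrightarrow> 1"
proof -
  show "approach_one n > 1" "approach_one n \<le> 2"
    by (auto simp: approach_one_def inverse_le_1_iff)
  show "approach_one \<longlonglongrightarrow> 1"
    using tendsto_add[OF tendsto_const[of 1] LIMSEQ_inverse_real_of_nat]
    unfolding approach_one_def[abs_def] by simp
qed

lemma norm_diff_squared_S2:
  assumes "\<xi> \<in> S2" "\<zeta> \<in> S2"
  shows "(norm (\<xi> - \<zeta>))\<^sup>2 = 2 - 2 * (\<xi> \<bullet> \<zeta>)"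
proof -
  have "\<xi> \<bullet> \<xi> = 1" "\<zeta> \<bullet> \<zeta> = 1"
    using assms by (simp_all add: dot_square_norm)
  then show ?thesis
    unfolding power2_norm_eq_inner inner_diff_left inner_diff_right inner_commute[of \<zeta> \<xi>] by linarith
qed

lemma inner_less_1_S2:
  assumes "\<xi> \<in> S2" "\<zeta> \<in> S2" "\<zeta> \<noteq> \<xi>"
  shows "\<xi> \<bullet> \<zeta> < 1"
proof -
  have "0 < (norm (\<xi> - \<zeta>))\<^sup>2" using assms(3) by simp
  also have "\<dots> = 2 - 2 * (\<xi> \<bullet> \<zeta>)"
    by (rule norm_diff_squared_S2[OF assms(1,2)])
  finally show ?thesis by simp
qed

text \<open>
  Monotone convergence along a sequence of parameters decreasing to \<open>1\<close>.
\<close>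

lemma integrable_inverse_sqrt_singularity:
  assumes \<xi>: "\<xi> \<in> S2"
  shows "integrable surface_measure (\<lambda>\<zeta>. 1 / sqrt (1 - \<xi> \<bullet> \<zeta>))"
proof -
  define u where "u = (\<lambda>n \<zeta>. 1 / sqrt (approach_one n - \<xi> \<bullet> \<zeta>))"
  have int_u: "integrable surface_measure (u n)" for n
    unfolding u_def
    by (intro integrable_continuous_surface_measure continuous_on_zonal continuous_on_kernels approach_one \<xi>)
  have mono: "u m \<zeta> \<le> u n \<zeta>" if "m \<le> n" "\<zeta> \<in> S2" for m n \<zeta>
  proof -
    have "approach_one n \<le> approach_one m"
      using that(1) by (simp add: approach_one_def)
    moreover have "approach_one n - \<xi> \<bullet> \<zeta> > 0" "approach_one m - \<xi> \<bullet> \<zeta> > 0"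
      using inner_S2_range[OF \<xi> that(2)] approach_one(1)[of n] approach_one(1)[of m] by auto
    ultimately show ?thesis
      unfolding u_def by (intro divide_left_mono) auto
  qed
  have "incseq (\<lambda>n. LINT \<zeta>|surface_measure. u n \<zeta>)"
    by (intro monoI integral_mono int_u) (use mono in \<open>auto simp: space_surface_measure\<close>)
  moreover have "(LINT \<zeta>|surface_measure. u n \<zeta>) \<le> 56 * pi" for n
    unfolding u_def by (intro integral_inverse_sqrt_bound approach_one \<xi>)
  ultimately obtain L where L: "(\<lambda>n. LINT \<zeta>|surface_measure. u n \<zeta>) \<longlonglongrightarrow> L"
    using incseq_convergent[of "\<lambda>n. LINT \<zeta>|surface_measure. u n \<zeta>" "56 * pi"] by blast
  show ?thesis
  proof (rule integrable_monotone_convergence[where f = u])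
    show "integrable surface_measure (u n)" for n by (rule int_u)
    show "AE \<zeta> in surface_measure. mono (\<lambda>n. u n \<zeta>)"
      by (intro AE_I2 monoI) (use mono in \<open>auto simp: space_surface_measure\<close>)
    show "AE \<zeta> in surface_measure. (\<lambda>n. u n \<zeta>) \<longlonglongrightarrow> 1 / sqrt (1 - \<xi> \<bullet> \<zeta>)"
      using AE_surface_measure_neq[OF \<xi>] AE_space
    proof eventually_elim
      case (elim \<zeta>)
      then have "\<xi> \<bullet> \<zeta> < 1"
        by (intro inner_less_1_S2 \<xi>) (auto simp: space_surface_measure)
      then show ?case
        unfolding u_def by (intro tendsto_intros approach_one) auto
    qed
    have "(\<lambda>\<zeta>. 1 / sqrt (1 - \<xi> \<bullet> \<zeta>)) \<in> borel_measurable (restrict_space borel S2)"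
      by (rule measurable_restrict_space1) measurable
    then show "(\<lambda>\<zeta>. 1 / sqrt (1 - \<xi> \<bullet> \<zeta>)) \<in> borel_measurable surface_measure"
      by (simp add: measurable_cong_sets[OF sets_surface_measure refl])
  qed (rule L)
qed

text \<open>
  The upper end \<open>3\<close> is the largest value of \<open>a - t\<close> for \<open>a \<le> 2\<close> and \<open>-1 \<le> t\<close>.
\<close>

lemma ln_squared_le_inverse_sqrt:
  assumes "0 < s" "s \<le> 3"
  shows "(ln s)\<^sup>2 \<le> 16 / sqrt s + 4"
proof (cases "s \<le> 1")
  case True
  \<comment> \<open>A fourth root suffices: \<open>ln s = 4 ln v\<close>, and \<open>\<bar>ln v\<bar> \<le> 1 / v\<close>, whose square is \<open>1 / sqrt s\<close>.\<close>
  define v where "v = sqrt (sqrt s)"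
  have v: "v > 0" "v \<le> 1" using assms True by (auto simp: v_def)
  have s: "sqrt s = v\<^sup>2"
    using assms by (simp add: v_def)
  have "s = (sqrt s)\<^sup>2"
    using assms by simp
  then have s4: "s = v ^ 4"
    by (simp only: s) simp
  have "ln (1 / v) \<le> 1 / v"
    using ln_le_minus_one[of "1 / v"] v by simp
  moreover have "0 \<le> ln (1 / v)" using v by simp
  ultimately have "(ln (1 / v))\<^sup>2 \<le> (1 / v)\<^sup>2"
    by (intro power_mono)
  moreover have "ln s = - 4 * ln (1 / v)"
    using v by (subst s4) (simp add: ln_realpow ln_div)
  ultimately show ?thesis
    by (simp add: s power_mult_distrib power_divide)
next
  case False
  then have "0 \<le> ln s" "ln s \<le> 2"
    using assms ln_le_minus_one[of s] by auto
  then have "(ln s)\<^sup>2 \<le> 2\<^sup>2" by (intro power_mono)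
  then have "(ln s)\<^sup>2 \<le> 4" by simp
  moreover have "0 \<le> 16 / sqrt s" using assms by simp
  ultimately show ?thesis by linarith
qed

lemma abs_ln_le_inverse_sqrt:
  assumes "0 < s" "s \<le> 3"
  shows "\<bar>ln s\<bar> \<le> 16 / sqrt s + 5"
proof -
  have "\<bar>ln s\<bar> \<le> 1 + (ln s)\<^sup>2"
  proof (cases "\<bar>ln s\<bar> \<le> 1")
    case False
    then have "\<bar>ln s\<bar> * 1 \<le> \<bar>ln s\<bar> * \<bar>ln s\<bar>" by (intro mult_left_mono) auto
    then show ?thesis by (simp add: power2_eq_square)
  qed (simp add: add_increasing2)
  with ln_squared_le_inverse_sqrt[OF assms] show ?thesis by simp
qed

lemma log_potential_integrable:
  assumes \<xi>: "\<xi> \<in> S2"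
  shows log_potential_measurable: "(\<lambda>\<zeta>. ln (1 - \<xi> \<bullet> \<zeta>)) \<in> borel_measurable surface_measure"
    and "integrable surface_measure (\<lambda>\<zeta>. ln (1 - \<xi> \<bullet> \<zeta>))"
    and log_potential_square_integrable: "integrable surface_measure (\<lambda>\<zeta>. (ln (1 - \<xi> \<bullet> \<zeta>))\<^sup>2)"
proof -
  have "(\<lambda>\<zeta>. ln (1 - \<xi> \<bullet> \<zeta>)) \<in> borel_measurable (restrict_space borel S2)"
    by (rule measurable_restrict_space1) measurable
  then show [measurable]: "(\<lambda>\<zeta>. ln (1 - \<xi> \<bullet> \<zeta>)) \<in> borel_measurable surface_measure"
    by (simp add: measurable_cong_sets[OF sets_surface_measure refl])
  have "AE \<zeta> in surface_measure. 0 < 1 - \<xi> \<bullet> \<zeta> \<and> 1 - \<xi> \<bullet> \<zeta> \<le> 3"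
    using AE_surface_measure_neq[OF \<xi>] AE_space
  proof eventually_elim
    case (elim \<zeta>)
    then have "\<zeta> \<in> S2" by (simp only: space_surface_measure)
    with inner_less_1_S2[OF \<xi> this] inner_S2_range[OF \<xi> this] elim(1) show ?case by auto
  qed
  then have bounds: "AE \<zeta> in surface_measure. \<bar>ln (1 - \<xi> \<bullet> \<zeta>)\<bar> \<le> 16 * (1 / sqrt (1 - \<xi> \<bullet> \<zeta>)) + 5"
     "AE \<zeta> in surface_measure. (ln (1 - \<xi> \<bullet> \<zeta>))\<^sup>2 \<le> 16 * (1 / sqrt (1 - \<xi> \<bullet> \<zeta>)) + 4"
    by (eventually_elim, use ln_squared_le_inverse_sqrt abs_ln_le_inverse_sqrt in simp)+
  have w: "integrable surface_measure (\<lambda>\<zeta>. 16 * (1 / sqrt (1 - \<xi> \<bullet> \<zeta>)) + c)" for c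
    by (intro Bochner_Integration.integrable_add integrable_mult_right integrable_inverse_sqrt_singularity \<xi>) simp
  show "integrable surface_measure (\<lambda>\<zeta>. ln (1 - \<xi> \<bullet> \<zeta>))"
    by (rule Bochner_Integration.integrable_bound[OF w[of 5]]) (use bounds(1) in \<open>auto elim: eventually_mono\<close>)
  show "integrable surface_measure (\<lambda>\<zeta>. (ln (1 - \<xi> \<bullet> \<zeta>))\<^sup>2)"
    by (rule Bochner_Integration.integrable_bound[OF w[of 4]]) (use bounds(2) in \<open>auto elim: eventually_mono\<close>)
qed

section \<open>Green's representation formula\<close>

text \<open>
  A modulus of continuity adapted to the kernel: \<open>1 - \<xi> \<bullet> \<zeta>\<close> is half the squared distance, and its square
  is at most the denominator of \<open>poisson a (\<xi> \<bullet> \<zeta>)\<close>.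
\<close>

lemma continuous_S2_modulus:
  fixes f :: "real ^ 3 \<Rightarrow> complex"
  assumes cont: "continuous_on S2 f" and \<xi>: "\<xi> \<in> S2" and e: "0 < e"
  obtains C where "\<And>\<zeta>. \<zeta> \<in> S2 \<Longrightarrow> norm (f \<zeta> - f \<xi>) \<le> e + C * (1 - \<xi> \<bullet> \<zeta>)\<^sup>2" and "0 \<le> C"
proof -
  obtain B where B: "0 \<le> B" "\<And>\<zeta>. \<zeta> \<in> S2 \<Longrightarrow> norm (f \<zeta>) \<le> B"
    using continuous_on_S2_bounded[OF cont] by blast
  obtain d where d: "d > 0" "\<And>\<zeta>. \<zeta> \<in> S2 \<Longrightarrow> dist \<zeta> \<xi> < d \<Longrightarrow> dist (f \<zeta>) (f \<xi>) < e"
    using cont \<xi> e unfolding continuous_on_iff by blast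
  define \<delta> where "\<delta> = d\<^sup>2 / 2"
  have \<delta>: "\<delta> > 0" using d by (simp add: \<delta>_def)
  show thesis
  proof
    show "0 \<le> 2 * B / \<delta>\<^sup>2" using B by simp
    fix \<zeta> assume \<zeta>: "\<zeta> \<in> S2"
    show "norm (f \<zeta> - f \<xi>) \<le> e + (2 * B / \<delta>\<^sup>2) * (1 - \<xi> \<bullet> \<zeta>)\<^sup>2"
    proof (cases "dist \<zeta> \<xi> < d")
      case True
      have "norm (f \<zeta> - f \<xi>) \<le> e" using d(2)[OF \<zeta> True] by (simp add: dist_norm)
      moreover have "0 \<le> (2 * B / \<delta>\<^sup>2) * (1 - \<xi> \<bullet> \<zeta>)\<^sup>2" using B by simp
      ultimately show ?thesis by linarith
    next
      case False
      then have "d\<^sup>2 \<le> (norm (\<xi> - \<zeta>))\<^sup>2"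
        using d(1) by (intro power_mono) (auto simp: dist_norm norm_minus_commute)
      also have "\<dots> = 2 - 2 * (\<xi> \<bullet> \<zeta>)"
        by (rule norm_diff_squared_S2[OF \<xi> \<zeta>])
      finally have "\<delta> \<le> 1 - \<xi> \<bullet> \<zeta>" by (simp add: \<delta>_def)
      then have "\<delta>\<^sup>2 \<le> (1 - \<xi> \<bullet> \<zeta>)\<^sup>2" using \<delta> by (intro power_mono) auto
      then have "1 \<le> (1 - \<xi> \<bullet> \<zeta>)\<^sup>2 / \<delta>\<^sup>2" using \<delta> by simp
      then have "2 * B * 1 \<le> 2 * B * ((1 - \<xi> \<bullet> \<zeta>)\<^sup>2 / \<delta>\<^sup>2)" using B(1) by (intro mult_left_mono) auto
      moreover have "norm (f \<zeta> - f \<xi>) \<le> 2 * B"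
        using norm_triangle_ineq4[of "f \<zeta>" "f \<xi>"] B(2)[OF \<zeta>] B(2)[OF \<xi>] by linarith
      ultimately show ?thesis using e by simp
    qed
  qed
qed

text \<open>
  The kernel is nonnegative with total mass \<open>4 \<pi>\<close>. By \<open>continuous_S2_modulus\<close>, its integral
  against \<open>cmod (f \<zeta> - f \<xi>)\<close> is at most \<open>4 \<pi> (e + C (a\<^sup>2 - 1))\<close>, where \<open>C\<close> depends on \<open>e\<close> but not on \<open>a\<close>.
\<close>

lemma poisson_approximate_identity:
  fixes f :: "real ^ 3 \<Rightarrow> complex"
  assumes cont: "continuous_on S2 f" and \<xi>: "\<xi> \<in> S2"
  shows "(\<lambda>n. LINT \<zeta>|surface_measure. poisson (approach_one n) (\<xi> \<bullet> \<zeta>) *\<^sub>R f \<zeta>) \<longlonglongrightarrow> (4 * pi) *\<^sub>R f \<xi>"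
proof -
  let ?P = "\<lambda>n \<zeta>. poisson (approach_one n) (\<xi> \<bullet> \<zeta>)"
  define I where "I = (\<lambda>n. LINT \<zeta>|surface_measure. ?P n \<zeta> *\<^sub>R f \<zeta>)"
  have int_P: "integrable surface_measure (?P n)" for n
    by (intro integrable_continuous_surface_measure continuous_on_zonal continuous_on_kernels approach_one \<xi>)
  have int_Pf: "integrable surface_measure (\<lambda>\<zeta>. ?P n \<zeta> *\<^sub>R f \<zeta>)" for n
    by (intro integrable_scaleR_continuous_surface_measure int_P cont)
  have est: "\<exists>C\<ge>0. \<forall>n. norm (I n - (4 * pi) *\<^sub>R f \<xi>) \<le> 4 * pi * e + C * ((approach_one n)\<^sup>2 - 1)" if e: "e > 0" for e
  proof -
    obtain C where C: "\<And>\<zeta>. \<zeta> \<in> S2 \<Longrightarrow> norm (f \<zeta> - f \<xi>) \<le> e + C * (1 - \<xi> \<bullet> \<zeta>)\<^sup>2" "0 \<le> C"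
      using continuous_S2_modulus[OF cont \<xi> e] by blast
    have "norm (I n - (4 * pi) *\<^sub>R f \<xi>) \<le> 4 * pi * e + (4 * pi * C) * ((approach_one n)\<^sup>2 - 1)" for n
    proof -
      define a where "a = approach_one n"
      have a: "a > 1" unfolding a_def by (rule approach_one)
      have "I n - (4 * pi) *\<^sub>R f \<xi> = I n - (LINT \<zeta>|surface_measure. ?P n \<zeta> *\<^sub>R f \<xi>)"
        using int_P[of n] by (simp add: integral_poisson[OF approach_one(1) \<xi>])
      also have "\<dots> = (LINT \<zeta>|surface_measure. ?P n \<zeta> *\<^sub>R (f \<zeta> - f \<xi>))"
        unfolding I_def scaleR_diff_right using int_P int_Pf by simp
      also have "norm \<dots> \<le> (LINT \<zeta>|surface_measure. norm (?P n \<zeta> *\<^sub>R (f \<zeta> - f \<xi>)))"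
        by (rule integral_norm_bound)
      also have "\<dots> \<le> (LINT \<zeta>|surface_measure. e * ?P n \<zeta> + C * (a\<^sup>2 - 1))"
      proof (rule integral_mono)
        show "integrable surface_measure (\<lambda>\<zeta>. norm (?P n \<zeta> *\<^sub>R (f \<zeta> - f \<xi>)))"
          by (intro integrable_norm integrable_scaleR_continuous_surface_measure int_P continuous_intros cont)
        show "integrable surface_measure (\<lambda>\<zeta>. e * ?P n \<zeta> + C * (a\<^sup>2 - 1))"
          using int_P by simp
        fix \<zeta> assume "\<zeta> \<in> space surface_measure"
        then have \<zeta>: "\<zeta> \<in> S2" by (simp only: space_surface_measure)
        have t: "\<xi> \<bullet> \<zeta> \<le> 1" using inner_S2_range[OF \<xi> \<zeta>] by simp
        have P: "0 \<le> ?P n \<zeta>" "?P n \<zeta> * (1 - \<xi> \<bullet> \<zeta>)\<^sup>2 \<le> a\<^sup>2 - 1"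
        proof -
          have a2: "a\<^sup>2 - 1 \<ge> 0" using a by simp
          then show "0 \<le> ?P n \<zeta>" by (simp add: poisson_def a_def[symmetric])
          have "(1 - \<xi> \<bullet> \<zeta>)\<^sup>2 \<le> (a - \<xi> \<bullet> \<zeta>)\<^sup>2" using t a by (intro power_mono) auto
          then have "(1 - \<xi> \<bullet> \<zeta>)\<^sup>2 / (a - \<xi> \<bullet> \<zeta>)\<^sup>2 \<le> 1" using t a by simp
          from mult_left_mono[OF this a2] show "?P n \<zeta> * (1 - \<xi> \<bullet> \<zeta>)\<^sup>2 \<le> a\<^sup>2 - 1"
            by (simp add: poisson_def a_def[symmetric])
        qed
        have "norm (?P n \<zeta> *\<^sub>R (f \<zeta> - f \<xi>)) \<le> ?P n \<zeta> * (e + C * (1 - \<xi> \<bullet> \<zeta>)\<^sup>2)"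
          using P(1) C(1)[OF \<zeta>] by (simp add: mult_left_mono)
        also have "\<dots> = e * ?P n \<zeta> + C * (?P n \<zeta> * (1 - \<xi> \<bullet> \<zeta>)\<^sup>2)"
          by (simp add: algebra_simps)
        also have "\<dots> \<le> e * ?P n \<zeta> + C * (a\<^sup>2 - 1)"
          using P(2) C(2) by (intro add_left_mono mult_left_mono)
        finally show "norm (?P n \<zeta> *\<^sub>R (f \<zeta> - f \<xi>)) \<le> e * ?P n \<zeta> + C * (a\<^sup>2 - 1)" .
      qed
      also have "\<dots> = 4 * pi * e + (4 * pi * C) * (a\<^sup>2 - 1)"
        using int_P[of n]
        by (simp add: integral_poisson[OF approach_one(1) \<xi>] space_surface_measure measure_surface_measure_S2)
      finally show ?thesis by (simp add: a_def)
    qed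
    with C(2) show ?thesis by (intro exI[of _ "4 * pi * C"]) simp
  qed
  have "I \<longlonglongrightarrow> (4 * pi) *\<^sub>R f \<xi>"
  proof (rule metric_LIMSEQ_I)
    fix r :: real assume r: "r > 0"
    define e where "e = r / (8 * pi)"
    have e: "e > 0" "4 * pi * e = r / 2" using r by (auto simp: e_def)
    obtain C where C: "\<And>n. norm (I n - (4 * pi) *\<^sub>R f \<xi>) \<le> r / 2 + C * ((approach_one n)\<^sup>2 - 1)"
      using est[OF e(1)] unfolding e(2) by blast
    have "(\<lambda>n. r / 2 + C * ((approach_one n)\<^sup>2 - 1)) \<longlonglongrightarrow> r / 2 + C * (1\<^sup>2 - 1)"
      by (intro tendsto_intros approach_one)
    then have "\<forall>\<^sub>F n in sequentially. r / 2 + C * ((approach_one n)\<^sup>2 - 1) < r"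
      by (rule order_tendstoD(2)) (use r in simp)
    then have "\<forall>\<^sub>F n in sequentially. dist (I n) ((4 * pi) *\<^sub>R f \<xi>) < r"
      unfolding dist_norm by eventually_elim (rule order_le_less_trans[OF C])
    then show "\<exists>no. \<forall>n\<ge>no. dist (I n) ((4 * pi) *\<^sub>R f \<xi>) < r"
      by (simp only: eventually_sequentially)
  qed
  then show ?thesis by (simp only: I_def)
qed

text \<open>
  Green's representation formula: integration against the logarithmic potential of a point recovers
  the value of an eigenfunction there, up to the mean and a factor that depends on the eigenvalue
  alone. Both sides of the identity for \<open>a > 1\<close> converge as \<open>a\<close> decreases to \<open>1\<close>, the left one because
  the kernel is an approximate identity, the right one by dominated convergence.
\<close>

lemma log_potential_eigenfunction:
  assumes C2: "C2_on (- {0}) (f \<circ> radial_proj)"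
    and cont: "continuous_on S2 f"
    and eigen: "\<And>\<zeta>. \<zeta> \<in> S2 \<Longrightarrow> laplace_beltrami f \<zeta> = \<mu> * f \<zeta>"
    and \<xi>: "\<xi> \<in> S2"
  shows "(4 * pi) *\<^sub>R f \<xi> - (LINT \<zeta>|surface_measure. f \<zeta>) =
    \<mu> * (LINT \<zeta>|surface_measure. ln (1 - \<xi> \<bullet> \<zeta>) *\<^sub>R f \<zeta>)"
proof -
  have [measurable]: "f \<in> borel_measurable surface_measure"
    by (rule borel_measurable_surface_measure_continuous[OF cont])
  obtain B where B: "0 \<le> B" "\<And>\<zeta>. \<zeta> \<in> S2 \<Longrightarrow> norm (f \<zeta>) \<le> B"
    using continuous_on_S2_bounded[OF cont] by blast
  have "(\<lambda>n. LINT \<zeta>|surface_measure. ln (approach_one n - \<xi> \<bullet> \<zeta>) *\<^sub>R f \<zeta>) \<longlonglongrightarrow>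
      (LINT \<zeta>|surface_measure. ln (1 - \<xi> \<bullet> \<zeta>) *\<^sub>R f \<zeta>)"
  proof (rule integral_dominated_convergence[where w = "\<lambda>\<zeta>. (16 * (1 / sqrt (1 - \<xi> \<bullet> \<zeta>)) + 5) * B"])
    show "(\<lambda>\<zeta>. ln (1 - \<xi> \<bullet> \<zeta>) *\<^sub>R f \<zeta>) \<in> borel_measurable surface_measure"
      using log_potential_measurable[OF \<xi>] by measurable
    show "(\<lambda>\<zeta>. ln (approach_one n - \<xi> \<bullet> \<zeta>) *\<^sub>R f \<zeta>) \<in> borel_measurable surface_measure" for n
      by (intro borel_measurable_integrable integrable_scaleR_continuous_surface_measure cont
          integrable_continuous_surface_measure continuous_on_zonal continuous_on_kernels approach_one \<xi>)
    show "integrable surface_measure (\<lambda>\<zeta>. (16 * (1 / sqrt (1 - \<xi> \<bullet> \<zeta>)) + 5) * B)"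
      by (intro integrable_mult_left Bochner_Integration.integrable_add integrable_mult_right
          integrable_inverse_sqrt_singularity \<xi>) simp
    show "AE \<zeta> in surface_measure. (\<lambda>n. ln (approach_one n - \<xi> \<bullet> \<zeta>) *\<^sub>R f \<zeta>) \<longlonglongrightarrow> ln (1 - \<xi> \<bullet> \<zeta>) *\<^sub>R f \<zeta>"
      using AE_surface_measure_neq[OF \<xi>] AE_space
    proof eventually_elim
      case (elim \<zeta>)
      then have "\<xi> \<bullet> \<zeta> < 1"
        by (intro inner_less_1_S2 \<xi>) (auto simp: space_surface_measure)
      then show ?case
        by (intro tendsto_intros approach_one) auto
    qed
    show "AE \<zeta> in surface_measure. norm (ln (approach_one n - \<xi> \<bullet> \<zeta>) *\<^sub>R f \<zeta>) \<le> (16 * (1 / sqrt (1 - \<xi> \<bullet> \<zeta>)) + 5) * B" for n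
      using AE_surface_measure_neq[OF \<xi>] AE_space
    proof eventually_elim
      case (elim \<zeta>)
      then have \<zeta>: "\<zeta> \<in> S2" by (simp only: space_surface_measure)
      have t: "\<xi> \<bullet> \<zeta> < 1" "-1 \<le> \<xi> \<bullet> \<zeta>"
        using inner_less_1_S2[OF \<xi> \<zeta> elim(1)] inner_S2_range[OF \<xi> \<zeta>] by auto
      have "\<bar>ln (approach_one n - \<xi> \<bullet> \<zeta>)\<bar> \<le> 16 / sqrt (approach_one n - \<xi> \<bullet> \<zeta>) + 5"
        using approach_one(1)[of n] approach_one(2)[of n] t by (intro abs_ln_le_inverse_sqrt) auto
      also have "16 / sqrt (approach_one n - \<xi> \<bullet> \<zeta>) \<le> 16 / sqrt (1 - \<xi> \<bullet> \<zeta>)"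
        using approach_one(1)[of n] t by (intro divide_left_mono) auto
      finally have "\<bar>ln (approach_one n - \<xi> \<bullet> \<zeta>)\<bar> \<le> 16 * (1 / sqrt (1 - \<xi> \<bullet> \<zeta>)) + 5"
        by simp
      then have "\<bar>ln (approach_one n - \<xi> \<bullet> \<zeta>)\<bar> * norm (f \<zeta>) \<le> (16 * (1 / sqrt (1 - \<xi> \<bullet> \<zeta>)) + 5) * B"
        using t by (intro mult_mono B \<zeta>) auto
      then show ?case by simp
    qed
  qed
  then have "(\<lambda>n. \<mu> * (LINT \<zeta>|surface_measure. ln (approach_one n - \<xi> \<bullet> \<zeta>) *\<^sub>R f \<zeta>)) \<longlonglongrightarrow>
      \<mu> * (LINT \<zeta>|surface_measure. ln (1 - \<xi> \<bullet> \<zeta>) *\<^sub>R f \<zeta>)"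
    by (intro tendsto_intros)
  moreover have "(\<lambda>n. (LINT \<zeta>|surface_measure. poisson (approach_one n) (\<xi> \<bullet> \<zeta>) *\<^sub>R f \<zeta>) - (LINT \<zeta>|surface_measure. f \<zeta>))
      \<longlonglongrightarrow> (4 * pi) *\<^sub>R f \<xi> - (LINT \<zeta>|surface_measure. f \<zeta>)"
    by (intro tendsto_intros poisson_approximate_identity cont \<xi>)
  ultimately show ?thesis
    by (simp only: integral_poisson_eigenfunction[OF C2 cont eigen approach_one(1) \<xi>])
       (rule LIMSEQ_unique; assumption)
qed

section \<open>Linear independence of point evaluations\<close>

lemma continuous_on_S2_eigenfunction:
  assumes "laplace_beltrami_eigenfunction f"
  shows "continuous_on S2 f"
proof (rule continuous_on_eq)
  have "(f \<circ> radial_proj) differentiable at x" if "x \<in> S2" for x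
    using assms that by (auto simp: laplace_beltrami_eigenfunction_def C2_on_def)
  then show "continuous_on S2 (f \<circ> radial_proj)"
    by (intro continuous_at_imp_continuous_on ballI differentiable_imp_continuous_within)
qed (auto simp: radial_proj_S2)

text \<open>
  If the combination \<open>c\<close> of point evaluations annihilates an eigenfunction \<open>f\<close>, then so does integration
  against the same combination of logarithmic potentials, once its mean \<open>\<kappa>\<close> is subtracted. For
  \<open>\<mu> \<noteq> 0\<close> this is the representation formula, as \<open>f\<close> has mean zero; for \<open>\<mu> = 0\<close> the formula says that \<open>f\<close> is
  constant, and the combination minus \<open>\<kappa>\<close> has mean zero.
\<close>

lemma log_potential_combination_orthogonal:
  fixes c :: "real ^ 3 \<Rightarrow> complex" and \<kappa> :: complex
  assumes \<Xi>: "\<Xi> \<subseteq> S2"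
    and f: "laplace_beltrami_eigenfunction f"
    and annihilates: "(\<Sum>\<xi>\<in>\<Xi>. c \<xi> * f \<xi>) = 0"
    and \<kappa>: "4 * pi * \<kappa> = (LINT \<zeta>|surface_measure. (\<Sum>\<xi>\<in>\<Xi>. c \<xi> * of_real (ln (1 - \<xi> \<bullet> \<zeta>))))"
  shows "(LINT \<zeta>|surface_measure. f \<zeta> * ((\<Sum>\<xi>\<in>\<Xi>. c \<xi> * of_real (ln (1 - \<xi> \<bullet> \<zeta>))) - \<kappa>)) = 0"
proof -
  define v where "v = (\<lambda>\<zeta>. \<Sum>\<xi>\<in>\<Xi>. c \<xi> * of_real (ln (1 - \<xi> \<bullet> \<zeta>)))"
  obtain \<mu> where C2: "C2_on (- {0}) (f \<circ> radial_proj)"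
    and eigen: "\<And>\<zeta>. \<zeta> \<in> S2 \<Longrightarrow> laplace_beltrami f \<zeta> = \<mu> * f \<zeta>"
    using f unfolding laplace_beltrami_eigenfunction_def by blast
  have cont: "continuous_on S2 f"
    by (rule continuous_on_S2_eigenfunction[OF f])
  have int_f: "integrable surface_measure f"
    by (rule integrable_continuous_surface_measure[OF cont])
  have int_lf: "integrable surface_measure (\<lambda>\<zeta>. ln (1 - \<xi> \<bullet> \<zeta>) *\<^sub>R f \<zeta>)" if "\<xi> \<in> \<Xi>" for \<xi>
    using that \<Xi> by (intro integrable_scaleR_continuous_surface_measure log_potential_integrable cont) auto
  have int_l: "integrable surface_measure (\<lambda>\<zeta>. complex_of_real (ln (1 - \<xi> \<bullet> \<zeta>)))" if "\<xi> \<in> \<Xi>" for \<xi>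
    using that \<Xi> by (intro integrable_of_real log_potential_integrable) auto
  have int_v: "integrable surface_measure v"
    unfolding v_def by (intro Bochner_Integration.integrable_sum integrable_mult_right int_l)
  have fv: "f \<zeta> * (v \<zeta> - \<kappa>) = (\<Sum>\<xi>\<in>\<Xi>. c \<xi> * (ln (1 - \<xi> \<bullet> \<zeta>) *\<^sub>R f \<zeta>)) - \<kappa> * f \<zeta>" for \<zeta>
    by (simp add: v_def scaleR_conv_of_real sum_distrib_left sum_distrib_right algebra_simps)
  have split: "(LINT \<zeta>|surface_measure. f \<zeta> * (v \<zeta> - \<kappa>)) =
      (\<Sum>\<xi>\<in>\<Xi>. c \<xi> * (LINT \<zeta>|surface_measure. ln (1 - \<xi> \<bullet> \<zeta>) *\<^sub>R f \<zeta>)) - \<kappa> * (LINT \<zeta>|surface_measure. f \<zeta>)"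
  proof -
    have int_s: "integrable surface_measure (\<lambda>\<zeta>. c \<xi> * (ln (1 - \<xi> \<bullet> \<zeta>) *\<^sub>R f \<zeta>))" if "\<xi> \<in> \<Xi>" for \<xi>
      by (intro integrable_mult_right int_lf that)
    show ?thesis
      unfolding fv
      by (subst Bochner_Integration.integral_diff[OF Bochner_Integration.integrable_sum[OF int_s] integrable_mult_right[OF int_f]],
          assumption, subst Bochner_Integration.integral_sum[OF int_s], assumption)
         (simp only: integral_mult_right_zero)
  qed
  have "(LINT \<zeta>|surface_measure. f \<zeta> * (v \<zeta> - \<kappa>)) = 0"
  proof (cases "\<mu> = 0")
    case True
    define m where "m = (LINT \<zeta>|surface_measure. f \<zeta>) / (4 * pi)"
    have const: "f \<zeta> = m" if "\<zeta> \<in> S2" for \<zeta>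
      using log_potential_eigenfunction[OF C2 cont eigen that] True
      by (simp add: m_def scaleR_conv_of_real field_simps)
    have "(LINT \<zeta>|surface_measure. f \<zeta> * (v \<zeta> - \<kappa>)) = (LINT \<zeta>|surface_measure. m * (v \<zeta> - \<kappa>))"
      by (rule Bochner_Integration.integral_cong[OF refl]) (use const in \<open>simp add: space_surface_measure\<close>)
    also have "\<dots> = m * ((LINT \<zeta>|surface_measure. v \<zeta>) - (4 * pi) *\<^sub>R \<kappa>)"
      using int_v by (simp add: space_surface_measure measure_surface_measure_S2)
    also have "\<dots> = 0"
      using \<kappa> by (simp add: v_def scaleR_conv_of_real)
    finally show ?thesis .
  next
    case False
    then have mean: "(LINT \<zeta>|surface_measure. f \<zeta>) = 0"
      using integral_eigenfunction[OF C2 eigen] by simp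
    have "\<mu> * (\<Sum>\<xi>\<in>\<Xi>. c \<xi> * (LINT \<zeta>|surface_measure. ln (1 - \<xi> \<bullet> \<zeta>) *\<^sub>R f \<zeta>)) =
      (\<Sum>\<xi>\<in>\<Xi>. c \<xi> * (\<mu> * (LINT \<zeta>|surface_measure. ln (1 - \<xi> \<bullet> \<zeta>) *\<^sub>R f \<zeta>)))"
      by (simp only: sum_distrib_left mult.left_commute)
    also have "\<dots> = (\<Sum>\<xi>\<in>\<Xi>. c \<xi> * ((4 * pi) *\<^sub>R f \<xi>))"
      using \<Xi> by (intro sum.cong refl) (simp only: log_potential_eigenfunction[OF C2 cont eigen, symmetric] mean diff_zero subset_iff)
    also have "\<dots> = (4 * pi) *\<^sub>R (\<Sum>\<xi>\<in>\<Xi>. c \<xi> * f \<xi>)"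
      by (simp only: scaleR_sum_right mult_scaleR_right)
    also have "\<dots> = 0" by (simp only: annihilates scaleR_zero_right)
    finally show ?thesis using False by (simp add: split mean)
  qed
  then show ?thesis by (simp only: v_def)
qed

text \<open>
  The points of the ball that project into \<open>U\<close> form a nonempty open set, which has positive volume.
\<close>

lemma surface_measure_relatively_open_pos:
  assumes U: "open U" "\<xi> \<in> U" and \<xi>: "\<xi> \<in> S2"
  shows "\<not> (AE \<zeta> in surface_measure. \<zeta> \<notin> U)"
proof
  assume AE: "AE \<zeta> in surface_measure. \<zeta> \<notin> U"
  let ?O = "{x \<in> ball 0 1 - {0}. radial_proj x \<in> U}"
  have sets: "S2 \<inter> U \<in> sets surface_measure"
    unfolding sets_surface_measure using U(1) by (auto simp: sets_restrict_space)
  have "AE \<zeta> in surface_measure. \<zeta> \<notin> S2 \<inter> U"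
    using AE by eventually_elim simp
  then have "emeasure surface_measure (S2 \<inter> U) = 0"
    using sets AE_iff_measurable[of "S2 \<inter> U" surface_measure "\<lambda>\<zeta>. \<zeta> \<notin> S2 \<inter> U"]
    by (auto simp: space_surface_measure Int_def)
  moreover have "{x \<in> ball 0 1 - {0}. radial_proj x \<in> S2 \<inter> U} = ?O"
    using radial_proj_in_S2 by auto
  ultimately have null: "emeasure lborel ?O = 0"
    using emeasure_surface_measure[of "S2 \<inter> U"] sets by (simp add: sets_surface_measure)
  have "open (radial_proj -` U \<inter> - {0})"
    by (rule continuous_open_preimage[OF continuous_on_radial_proj _ U(1), unfolded Int_commute[of "- {0}"]]) auto
  then have "open (ball 0 1 \<inter> (radial_proj -` U \<inter> - {0}))"
    using open_ball by (rule open_Int[rotated])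
  also have "ball 0 1 \<inter> (radial_proj -` U \<inter> - {0}) = ?O" by auto
  finally have op: "open ?O" .
  have "(1/2) *\<^sub>R \<xi> \<in> ?O"
    using \<xi> U(2) radial_proj_scaleR[of "1/2" \<xi>] radial_proj_S2[OF \<xi>] by auto
  then have "\<not> negligible ?O"
    using open_not_negligible[OF op] by blast
  moreover have "?O \<in> null_sets lborel"
    using null op by (intro null_setsI) auto
  then have "negligible ?O"
    by (simp add: negligible_iff_null_sets null_sets_completionI)
  ultimately show False by blast
qed

text \<open>
  Near \<open>\<xi>0\<close> the summand of \<open>\<xi>0\<close> is unbounded, while the others converge. So the combination differs from
  \<open>\<kappa>\<close> on a punctured neighbourhood of \<open>\<xi>0\<close>, and that has positive measure.
\<close>

lemma log_potential_combination_not_constant: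
  fixes c :: "real ^ 3 \<Rightarrow> complex" and \<kappa> :: complex
  assumes fin: "finite \<Xi>" and \<Xi>: "\<Xi> \<subseteq> S2" and \<xi>0: "\<xi>0 \<in> \<Xi>" and c: "c \<xi>0 \<noteq> 0"
  shows "\<not> (AE \<zeta> in surface_measure. (\<Sum>\<xi>\<in>\<Xi>. c \<xi> * complex_of_real (ln (1 - \<xi> \<bullet> \<zeta>))) = \<kappa>)"
proof
  define v where "v = (\<lambda>\<zeta>. \<Sum>\<xi>\<in>\<Xi>. c \<xi> * complex_of_real (ln (1 - \<xi> \<bullet> \<zeta>)))"
  assume AE: "AE \<zeta> in surface_measure. (\<Sum>\<xi>\<in>\<Xi>. c \<xi> * complex_of_real (ln (1 - \<xi> \<bullet> \<zeta>))) = \<kappa>"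
  let ?F = "at \<xi>0 within S2"
  have S2: "\<xi>0 \<in> S2" using \<xi>0 \<Xi> by auto
  have rest: "((\<lambda>\<zeta>. (\<Sum>\<xi>\<in>\<Xi> - {\<xi>0}. c \<xi> * complex_of_real (ln (1 - \<xi> \<bullet> \<zeta>))) - \<kappa>) \<longlongrightarrow>
      (\<Sum>\<xi>\<in>\<Xi> - {\<xi>0}. c \<xi> * complex_of_real (ln (1 - \<xi> \<bullet> \<xi>0))) - \<kappa>) ?F"
  proof (intro tendsto_intros)
    fix \<xi> assume "\<xi> \<in> \<Xi> - {\<xi>0}"
    then have "\<xi> \<bullet> \<xi>0 < 1"
      using \<Xi> S2 by (intro inner_less_1_S2) auto
    then show "1 - \<xi> \<bullet> \<xi>0 \<noteq> 0" by simp
  qed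
  have "filterlim (\<lambda>\<zeta>. 1 - \<xi>0 \<bullet> \<zeta>) (at_right 0) ?F"
    unfolding filterlim_at
  proof
    have "\<xi>0 \<bullet> \<xi>0 = 1" using S2 by (simp add: dot_square_norm)
    moreover have "((\<lambda>\<zeta>. 1 - \<xi>0 \<bullet> \<zeta>) \<longlongrightarrow> 1 - \<xi>0 \<bullet> \<xi>0) ?F"
      by (intro tendsto_intros)
    ultimately show "((\<lambda>\<zeta>. 1 - \<xi>0 \<bullet> \<zeta>) \<longlongrightarrow> 0) ?F" by simp
    show "\<forall>\<^sub>F \<zeta> in ?F. 1 - \<xi>0 \<bullet> \<zeta> \<in> {0<..} \<and> 1 - \<xi>0 \<bullet> \<zeta> \<noteq> 0"
      unfolding eventually_at_filter
      by (intro always_eventually allI impI) (use inner_less_1_S2[OF S2] in force)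
  qed
  then have "filterlim (\<lambda>\<zeta>. ln (1 - \<xi>0 \<bullet> \<zeta>)) at_bot ?F"
    by (rule filterlim_compose[OF ln_at_0])
  then have "filterlim (\<lambda>\<zeta>. ln (1 - \<xi>0 \<bullet> \<zeta>)) at_infinity ?F"
    by (rule filterlim_mono[OF _ at_bot_le_at_infinity order_refl])
  then have "filterlim (\<lambda>\<zeta>. norm (ln (1 - \<xi>0 \<bullet> \<zeta>))) at_top ?F"
    by (rule filterlim_compose[OF filterlim_norm_at_top])
  then have "filterlim (\<lambda>\<zeta>. norm (c \<xi>0) * norm (ln (1 - \<xi>0 \<bullet> \<zeta>))) at_top ?F"
    using c by (intro filterlim_tendsto_pos_mult_at_top[OF tendsto_const]) auto
  then have "filterlim (\<lambda>\<zeta>. c \<xi>0 * complex_of_real (ln (1 - \<xi>0 \<bullet> \<zeta>))) at_infinity ?F"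
    by (intro filterlim_norm_at_top_imp_at_infinity) (simp add: norm_mult)
  from tendsto_add_filterlim_at_infinity[OF rest this]
  have "filterlim (\<lambda>\<zeta>. v \<zeta> - \<kappa>) at_infinity ?F"
    using fin \<xi>0 by (simp add: v_def sum.remove[of \<Xi> \<xi>0] algebra_simps)
  then have "\<forall>\<^sub>F \<zeta> in ?F. v \<zeta> - \<kappa> \<noteq> 0"
    by (rule filterlim_at_infinity_imp_eventually_ne)
  then obtain U where U: "open U" "\<xi>0 \<in> U" "\<And>\<zeta>. \<zeta> \<in> U \<Longrightarrow> \<zeta> \<noteq> \<xi>0 \<Longrightarrow> \<zeta> \<in> S2 \<Longrightarrow> v \<zeta> - \<kappa> \<noteq> 0"
    unfolding eventually_at_topological by blast
  have "AE \<zeta> in surface_measure. \<zeta> \<notin> U"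
    using AE AE_surface_measure_neq[OF S2] AE_space
  proof eventually_elim
    case (elim \<zeta>)
    then show ?case using U(3)[of \<zeta>] by (auto simp: v_def space_surface_measure)
  qed
  then show False
    using surface_measure_relatively_open_pos[OF U(1,2) S2] by blast
qed

text \<open>
  Let \<open>v\<close> be the combination with coefficients \<open>c\<close> of logarithmic potentials, and \<open>\<kappa>\<close> its mean. Then
  \<open>v - \<kappa>\<close> is square integrable and integrates to zero against every \<open>F l\<close>; by completeness of the
  basis it vanishes almost everywhere, which is impossible if some \<open>c \<xi>0\<close> is not zero. The inner product
  is conjugate linear in \<open>F l\<close>, so completeness is applied to the conjugate of \<open>v - \<kappa>\<close>.
\<close>

theorem evaluations_linearly_independent:
  fixes c :: "real ^ 3 \<Rightarrow> complex"
  assumes basis: "L2_orthonormal_basis F"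
    and eigenfunctions: "\<And>l. laplace_beltrami_eigenfunction (F l)"
    and fin: "finite \<Xi>" and \<Xi>: "\<Xi> \<subseteq> S2"
    and zero: "\<And>l. (\<Sum>\<xi>\<in>\<Xi>. c \<xi> * F l \<xi>) = 0" and \<xi>0: "\<xi>0 \<in> \<Xi>"
  shows "c \<xi>0 = 0"
proof (rule ccontr)
  assume c: "c \<xi>0 \<noteq> 0"
  define v where "v = (\<lambda>\<zeta>. \<Sum>\<xi>\<in>\<Xi>. c \<xi> * complex_of_real (ln (1 - \<xi> \<bullet> \<zeta>)))"
  define \<kappa> where "\<kappa> = (LINT \<zeta>|surface_measure. v \<zeta>) / (4 * pi)"
  define g where "g = (\<lambda>\<zeta>. cnj (v \<zeta> - \<kappa>))"
  have \<kappa>: "4 * pi * \<kappa> = (LINT \<zeta>|surface_measure. (\<Sum>\<xi>\<in>\<Xi>. c \<xi> * of_real (ln (1 - \<xi> \<bullet> \<zeta>))))"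
    by (simp add: \<kappa>_def v_def)
  have v_meas: "v \<in> borel_measurable surface_measure"
    unfolding v_def using \<Xi>
    by (intro borel_measurable_integrable Bochner_Integration.integrable_sum integrable_mult_right
        integrable_of_real log_potential_integrable) auto
  have g_meas: "g \<in> borel_measurable surface_measure"
    unfolding g_def using v_meas
    by (intro measurable_compose[OF _ borel_measurable_continuous_onI[OF continuous_on_cnj[OF continuous_on_id]]]) auto
  have sq: "square_integrable g"
    unfolding square_integrable_def
  proof
    show "g \<in> borel_measurable surface_measure" by (rule g_meas)
    \<comment> \<open>An integrable majorant of \<open>\<bar>v - \<kappa>\<bar>\<^sup>2\<close>, from \<open>(p + q)\<^sup>2 \<le> 2 p\<^sup>2 + 2 q\<^sup>2\<close> and the Cauchy-Schwarz inequality for the sum over \<open>\<Xi>\<close>.\<close>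
    define w where "w = (\<lambda>\<zeta>. 2 * (card \<Xi> * (\<Sum>\<xi>\<in>\<Xi>. (cmod (c \<xi>))\<^sup>2 * (ln (1 - \<xi> \<bullet> \<zeta>))\<^sup>2)) + 2 * (cmod \<kappa>)\<^sup>2)"
    show "integrable surface_measure (\<lambda>\<zeta>. (cmod (g \<zeta>))\<^sup>2)"
    proof (rule Bochner_Integration.integrable_bound[where f = w])
      show "integrable surface_measure w"
        unfolding w_def using \<Xi>
        by (intro Bochner_Integration.integrable_add integrable_mult_right Bochner_Integration.integrable_sum
            log_potential_square_integrable surface.integrable_const) auto
      show "(\<lambda>\<zeta>. (cmod (g \<zeta>))\<^sup>2) \<in> borel_measurable surface_measure"
        using g_meas by measurable
      have bound: "(cmod (g \<zeta>))\<^sup>2 \<le> w \<zeta>" for \<zeta>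
      proof -
        have "cmod (g \<zeta>) \<le> cmod (v \<zeta>) + cmod \<kappa>"
          by (simp add: g_def complex_mod_cnj norm_triangle_ineq4 del: complex_cnj_diff)
        then have "(cmod (g \<zeta>))\<^sup>2 \<le> (cmod (v \<zeta>) + cmod \<kappa>)\<^sup>2"
          by (intro power_mono) auto
        also have "\<dots> \<le> 2 * (cmod (v \<zeta>))\<^sup>2 + 2 * (cmod \<kappa>)\<^sup>2"
          using sum_squares_bound[of "cmod (v \<zeta>)" "cmod \<kappa>"] by (simp add: power2_sum)
        also have "(cmod (v \<zeta>))\<^sup>2 \<le> (\<Sum>\<xi>\<in>\<Xi>. cmod (c \<xi>) * \<bar>ln (1 - \<xi> \<bullet> \<zeta>)\<bar>)\<^sup>2"
          unfolding v_def by (intro power_mono order_trans[OF norm_sum]) (auto simp: norm_mult)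
        also have "\<dots> \<le> card \<Xi> * (\<Sum>\<xi>\<in>\<Xi>. (cmod (c \<xi>) * \<bar>ln (1 - \<xi> \<bullet> \<zeta>)\<bar>)\<^sup>2)"
          by (subst mult.commute) (rule sum_squared_le_sum_of_squares)
        also have "\<dots> = card \<Xi> * (\<Sum>\<xi>\<in>\<Xi>. (cmod (c \<xi>))\<^sup>2 * (ln (1 - \<xi> \<bullet> \<zeta>))\<^sup>2)"
          by (simp add: power_mult_distrib)
        finally show ?thesis by (simp add: w_def)
      qed
      then show "AE \<zeta> in surface_measure. norm ((cmod (g \<zeta>))\<^sup>2) \<le> norm (w \<zeta>)"
        by (intro AE_I2) (smt (verit) real_norm_def zero_le_power2)
    qed
  qed
  have orth: "L2_inner (F l) g = 0" for l
  proof -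
    have "L2_inner (F l) g = cnj (LINT \<zeta>|surface_measure. F l \<zeta> * (v \<zeta> - \<kappa>))"
      unfolding L2_inner_def g_def complex_cnj_mult[symmetric] by (rule Bochner_Integration.integral_cnj)
    also have "(LINT \<zeta>|surface_measure. F l \<zeta> * (v \<zeta> - \<kappa>)) = 0"
      unfolding v_def
      by (rule log_potential_combination_orthogonal[OF \<Xi> eigenfunctions zero \<kappa>])
    finally show ?thesis by simp
  qed
  have "(\<lambda>n. LINT \<xi>|surface_measure. (cmod (g \<xi> - (\<Sum>l<n. L2_inner (F l) g * F l \<xi>)))\<^sup>2) \<longlonglongrightarrow> 0"
    using basis sq unfolding L2_orthonormal_basis_def by blast
  then have "(LINT \<xi>|surface_measure. (cmod (g \<xi>))\<^sup>2) = 0"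
    by (simp add: orth LIMSEQ_const_iff)
  then have "AE \<zeta> in surface_measure. (cmod (g \<zeta>))\<^sup>2 = 0"
    using sq by (subst (asm) integral_nonneg_eq_0_iff_AE) (auto simp: square_integrable_def)
  then have "AE \<zeta> in surface_measure. (\<Sum>\<xi>\<in>\<Xi>. c \<xi> * complex_of_real (ln (1 - \<xi> \<bullet> \<zeta>))) = \<kappa>"
    by eventually_elim (simp add: g_def v_def del: complex_cnj_diff)
  then show False
    using log_potential_combination_not_constant[where c = c, OF fin \<Xi> \<xi>0 c] by blast
qed

section \<open>Comparison of the quadratic forms\<close>

definition eval_comb :: "(nat \<Rightarrow> real ^ 3 \<Rightarrow> complex) \<Rightarrow> (real ^ 3) set \<Rightarrow> (real ^ 3 \<Rightarrow> complex) \<Rightarrow> nat \<Rightarrow> complex" where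
  "eval_comb F \<Xi> c l = (\<Sum>\<xi>\<in>\<Xi>. c \<xi> * F l \<xi>)"

lemma sum_fun_apply: "(\<Sum>a\<in>A. f a) x = (\<Sum>a\<in>A. f a x)"
  for f :: "'a \<Rightarrow> 'b \<Rightarrow> 'c::comm_monoid_add"
  by (induction A rule: infinite_finite_induct) auto

lemma eval_comb_eq_sum: "eval_comb F \<Xi> c = (\<Sum>\<xi>\<in>\<Xi>. (\<lambda>l. c \<xi> * F l \<xi>))"
  by (simp add: fun_eq_iff eval_comb_def sum_fun_apply)

lemma eval_comb_in_eval_span:
  assumes "\<Xi> \<subseteq> S2"
  shows "eval_comb F \<Xi> c \<in> eval_span F"
proof -
  have "(\<lambda>l. c \<xi> * F l \<xi>) \<in> eval_span F" if "\<xi> \<in> \<Xi>" for \<xi>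
    unfolding eval_span_def using that assms
    by (intro cseq.span_scale[of "\<lambda>l. F l \<xi>"] cseq.span_base) auto
  then show ?thesis
    unfolding eval_comb_eq_sum eval_span_def by (rule cseq.span_sum)
qed

text \<open>
  Different points of the sphere could a priori have the same evaluation sequence; choosing one point
  for each sequence makes the coefficients a function of the points.
\<close>

lemma eval_span_cases:
  assumes "y \<in> eval_span F"
  obtains \<Xi> c where "finite \<Xi>" and "\<Xi> \<subseteq> S2" and "y = eval_comb F \<Xi> c"
proof -
  obtain T r where T: "finite T" "T \<subseteq> (\<lambda>\<xi> l. F l \<xi>) ` S2" and y: "y = (\<Sum>v\<in>T. (\<lambda>l. r v * v l))"
    using assms unfolding eval_span_def cseq.span_explicit by blast
  obtain \<Xi> where \<Xi>: "\<Xi> \<subseteq> S2" "inj_on (\<lambda>\<xi> l. F l \<xi>) \<Xi>" "T = (\<lambda>\<xi> l. F l \<xi>) ` \<Xi>"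
    using T(2) unfolding subset_image_inj by blast
  show thesis
  proof
    show "finite \<Xi>" using T(1) \<Xi>(2,3) finite_imageD by blast
    show "\<Xi> \<subseteq> S2" by (rule \<Xi>(1))
    show "y = eval_comb F \<Xi> (\<lambda>\<xi>. r (\<lambda>l. F l \<xi>))"
      unfolding y \<Xi>(3) eval_comb_eq_sum by (simp add: sum.reindex[OF \<Xi>(2)])
  qed
qed

text \<open>
  The two quadratic forms are the same double sum over the points, with the conjugates of the entries
  of \<open>x\<close> as coefficients of the evaluation sequences. The expansion says only that the inner series converge after
  multiplication by the conjugate of \<open>F l' \<zeta>\<close>; since \<open>F l'\<close> does not vanish identically, a suitable \<open>\<zeta>\<close> allows
  to divide, and the sums over the finite set of points can be exchanged with both limits.
\<close>

lemma quadratic_form_eq_seq_inner: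
  assumes nonzero: "\<And>l. \<exists>\<zeta>\<in>S2. F l \<zeta> \<noteq> 0"
    and expansion: "\<And>\<xi> \<zeta>. \<xi> \<in> S2 \<Longrightarrow> \<zeta> \<in> S2 \<Longrightarrow>
      iterated_sums (\<lambda>l l'. a l l' * F l \<xi> * cnj (F l' \<zeta>)) (K \<xi> \<zeta>)"
    and \<Xi>: "\<Xi> \<subseteq> S2"
  shows "fin_inner \<Xi> (kernel_matrix_op K \<Xi> x) x =
    seq_inner (coeff_op a (eval_comb F \<Xi> (cnj \<circ> x))) (eval_comb F \<Xi> (cnj \<circ> x))"
proof -
  let ?y = "eval_comb F \<Xi> (cnj \<circ> x)"
  define S where "S = (\<lambda>l' \<xi>. \<Sum>l. a l l' * F l \<xi>)"
  have summable: "summable (\<lambda>l. a l l' * F l \<xi>)" if \<xi>: "\<xi> \<in> S2" for l' \<xi>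
  proof -
    obtain \<zeta> where \<zeta>: "\<zeta> \<in> S2" "F l' \<zeta> \<noteq> 0" using nonzero by blast
    have "summable (\<lambda>l. a l l' * F l \<xi> * cnj (F l' \<zeta>))"
      using expansion[OF \<xi> \<zeta>(1)] by (simp add: iterated_sums_def)
    from summable_mult2[OF this, of "inverse (cnj (F l' \<zeta>))"] show ?thesis
      using \<zeta>(2) by (simp add: mult.assoc)
  qed
  have sums_K: "(\<lambda>l'. S l' \<xi> * cnj (F l' \<zeta>)) sums K \<xi> \<zeta>" if "\<xi> \<in> S2" "\<zeta> \<in> S2" for \<xi> \<zeta>
    using expansion[OF that] suminf_mult2[OF summable[OF that(1)]]
    by (simp add: iterated_sums_def S_def)
  have A: "coeff_op a ?y l' = (\<Sum>\<xi>\<in>\<Xi>. cnj (x \<xi>) * S l' \<xi>)" for l'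
  proof -
    have "(\<lambda>l. \<Sum>\<xi>\<in>\<Xi>. cnj (x \<xi>) * (a l l' * F l \<xi>)) sums (\<Sum>\<xi>\<in>\<Xi>. cnj (x \<xi>) * S l' \<xi>)"
      unfolding S_def using \<Xi> by (intro sums_sum sums_mult summable_sums summable) auto
    also have "(\<lambda>l. \<Sum>\<xi>\<in>\<Xi>. cnj (x \<xi>) * (a l l' * F l \<xi>)) = (\<lambda>l. a l l' * ?y l)"
      by (simp add: eval_comb_def sum_distrib_left ac_simps)
    finally show ?thesis
      unfolding coeff_op_def by (rule sums_unique[symmetric])
  qed
  have "(\<lambda>l'. \<Sum>\<xi>\<in>\<Xi>. \<Sum>\<zeta>\<in>\<Xi>. cnj (cnj (x \<xi>) * x \<zeta> * (S l' \<xi> * cnj (F l' \<zeta>)))) sums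
      (\<Sum>\<xi>\<in>\<Xi>. \<Sum>\<zeta>\<in>\<Xi>. cnj (cnj (x \<xi>) * x \<zeta> * K \<xi> \<zeta>))"
    using \<Xi> by (intro sums_sum sums_cnj[THEN iffD2] sums_mult sums_K) auto
  also have "(\<lambda>l'. \<Sum>\<xi>\<in>\<Xi>. \<Sum>\<zeta>\<in>\<Xi>. cnj (cnj (x \<xi>) * x \<zeta> * (S l' \<xi> * cnj (F l' \<zeta>)))) =
      (\<lambda>l'. cnj (coeff_op a ?y l') * ?y l')"
    by (simp add: A eval_comb_def sum_product ac_simps)
  also have "(\<Sum>\<xi>\<in>\<Xi>. \<Sum>\<zeta>\<in>\<Xi>. cnj (cnj (x \<xi>) * x \<zeta> * K \<xi> \<zeta>)) = fin_inner \<Xi> (kernel_matrix_op K \<Xi> x) x"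
    by (simp add: fin_inner_def kernel_matrix_op_def sum_distrib_left sum_distrib_right ac_simps)
  finally show ?thesis
    unfolding seq_inner_def by (rule sums_unique)
qed

lemma kernel_matrix_op_self_adjoint:
  assumes "\<forall>\<xi>\<in>\<Xi>. \<forall>\<zeta>\<in>\<Xi>. K \<xi> \<zeta> = cnj (K \<zeta> \<xi>)"
  shows "fin_inner \<Xi> (kernel_matrix_op K \<Xi> x) y = fin_inner \<Xi> x (kernel_matrix_op K \<Xi> y)"
proof -
  have "fin_inner \<Xi> (kernel_matrix_op K \<Xi> x) y = (\<Sum>\<xi>\<in>\<Xi>. \<Sum>\<zeta>\<in>\<Xi>. cnj (x \<zeta>) * (cnj (K \<xi> \<zeta>) * y \<xi>))"
    by (simp add: fin_inner_def kernel_matrix_op_def sum_distrib_left sum_distrib_right ac_simps)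
  also have "\<dots> = (\<Sum>\<xi>\<in>\<Xi>. \<Sum>\<zeta>\<in>\<Xi>. cnj (x \<zeta>) * (K \<zeta> \<xi> * y \<xi>))"
  proof (intro sum.cong refl)
    fix \<xi> \<zeta> assume "\<xi> \<in> \<Xi>" "\<zeta> \<in> \<Xi>"
    with assms have "K \<zeta> \<xi> = cnj (K \<xi> \<zeta>)" by blast
    then show "cnj (x \<zeta>) * (cnj (K \<xi> \<zeta>) * y \<xi>) = cnj (x \<zeta>) * (K \<zeta> \<xi> * y \<xi>)"
      by (simp only:)
  qed
  also have "\<dots> = (\<Sum>\<zeta>\<in>\<Xi>. \<Sum>\<xi>\<in>\<Xi>. cnj (x \<zeta>) * (K \<zeta> \<xi> * y \<xi>))"
    by (rule sum.swap)
  also have "\<dots> = fin_inner \<Xi> x (kernel_matrix_op K \<Xi> y)"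
    by (simp add: fin_inner_def kernel_matrix_op_def sum_distrib_left)
  finally show ?thesis .
qed

theorem theorem2:
  fixes K :: "real ^ 3 \<Rightarrow> real ^ 3 \<Rightarrow> complex"
    and F :: "nat \<Rightarrow> real ^ 3 \<Rightarrow> complex"
  assumes continuous: "continuous_on (S2 \<times> S2) (\<lambda>(\<xi>, \<zeta>). K \<xi> \<zeta>)"
    and hermitian: "\<forall>\<xi>\<in>S2. \<forall>\<zeta>\<in>S2. K \<xi> \<zeta> = cnj (K \<zeta> \<xi>)"
    and basis: "L2_orthonormal_basis F"
    and eigenfunctions: "\<forall>l. laplace_beltrami_eigenfunction (F l)"
    and expansion:
      "\<forall>\<xi>\<in>S2. \<forall>\<zeta>\<in>S2.
         iterated_sums (\<lambda>l l'. kernel_coeff K F l l' * F l \<xi> * cnj (F l' \<zeta>)) (K \<xi> \<zeta>)"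
  shows "strictly_positive_definite K \<longleftrightarrow>
    (\<forall>y \<in> eval_span F - {0}. 0 < seq_inner (coeff_op (kernel_coeff K F) y) y)"
proof -
  have quadratic_form: "fin_inner \<Xi> (kernel_matrix_op K \<Xi> x) x =
      seq_inner (coeff_op (kernel_coeff K F) (eval_comb F \<Xi> (cnj \<circ> x))) (eval_comb F \<Xi> (cnj \<circ> x))"
    if "\<Xi> \<subseteq> S2" for \<Xi> x
  proof (rule quadratic_form_eq_seq_inner[OF _ _ that])
    show "\<exists>\<zeta>\<in>S2. F l \<zeta> \<noteq> 0" for l
      using eigenfunctions unfolding laplace_beltrami_eigenfunction_def by blast
  qed (use expansion in blast)
  show ?thesis
  proof
    assume spd: "strictly_positive_definite K"
    show "\<forall>y \<in> eval_span F - {0}. 0 < seq_inner (coeff_op (kernel_coeff K F) y) y"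
    proof
      fix y assume y: "y \<in> eval_span F - {0}"
      then have "y \<in> eval_span F" by blast
      then obtain \<Xi> c where \<Xi>: "finite \<Xi>" "\<Xi> \<subseteq> S2" and yc: "y = eval_comb F \<Xi> c"
        by (rule eval_span_cases)
      have "\<exists>\<xi>\<in>\<Xi>. (cnj \<circ> c) \<xi> \<noteq> 0"
      proof (rule ccontr)
        assume "\<not> ?thesis"
        then have "y = 0" by (simp add: yc eval_comb_def fun_eq_iff)
        with y show False by simp
      qed
      then have "0 < fin_inner \<Xi> (kernel_matrix_op K \<Xi> (cnj \<circ> c)) (cnj \<circ> c)"
        using spd \<Xi> unfolding strictly_positive_definite_def strictly_positive_op_def by blast
      moreover have "cnj \<circ> (cnj \<circ> c) = c" by (simp add: fun_eq_iff)
      ultimately show "0 < seq_inner (coeff_op (kernel_coeff K F) y) y"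
        by (simp only: quadratic_form[OF \<Xi>(2)] yc)
    qed
  next
    assume pos: "\<forall>y \<in> eval_span F - {0}. 0 < seq_inner (coeff_op (kernel_coeff K F) y) y"
    have "0 < fin_inner \<Xi> (kernel_matrix_op K \<Xi> x) x"
      if \<Xi>: "finite \<Xi>" "\<Xi> \<subseteq> S2" and \<xi>0: "\<xi>0 \<in> \<Xi>" "x \<xi>0 \<noteq> 0" for \<Xi> x \<xi>0
    proof -
      have "eval_comb F \<Xi> (cnj \<circ> x) \<noteq> 0"
      proof
        assume zero: "eval_comb F \<Xi> (cnj \<circ> x) = 0"
        have "(cnj \<circ> x) \<xi>0 = 0"
        proof (rule evaluations_linearly_independent[OF basis _ \<Xi> _ \<xi>0(1)])
          show "(\<Sum>\<xi>\<in>\<Xi>. (cnj \<circ> x) \<xi> * F l \<xi>) = 0" for l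
            using fun_cong[OF zero, of l] by (simp add: eval_comb_def)
        qed (use eigenfunctions in blast)
        with \<xi>0(2) show False by simp
      qed
      with pos eval_comb_in_eval_span[OF \<Xi>(2)] show ?thesis
        unfolding quadratic_form[OF \<Xi>(2)] by blast
    qed
    moreover have "fin_inner \<Xi> (kernel_matrix_op K \<Xi> x) y = fin_inner \<Xi> x (kernel_matrix_op K \<Xi> y)"
      if "\<Xi> \<subseteq> S2" for \<Xi> x y
      by (rule kernel_matrix_op_self_adjoint) (use hermitian that in blast)
    ultimately show "strictly_positive_definite K"
      unfolding strictly_positive_definite_def strictly_positive_op_def by blast
  qed
qed

end
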